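(* An $\omega$-narrow topological group $X$ of countable pseudocharacter is $\mathsf{i}{:}\mathsf{TG}$-closed if and only if $X$ is complete and minimal.
   Context: All topological groups are assumed Hausdorff. A topological group $X$ is $\omega$-narrow if for every neighborhood $U\subset X$ of the unit there is a countable set $C\subset X$ with $X=CU$. A topological space $X$ has countable pseudocharacter if for each $x\in X$ there is a countable family $\mathcal U$ of open sets with $\bigcap\mathcal U=\{x\}$. $X$ is $\mathsf{i}{:}\mathsf{TG}$-closed if for every injective continuous homomorphism $f:X\to Y$ to a Hausdorff topological group $Y$ the image $f(X)$ is closed in $Y$. $X$ is complete if it is complete in its two-sided uniformity, generated by the entourages $\{(x,y)\in X\times X:y\in xU\cap Ux\}$, $U$ a neighborhood of the unit. $X$ is minimal if each continuous bijective homomorphism $h:X\to Y$ to a Hausdorff topological group $Y$ is open (equivalently, a topological isomorphism). *)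

theory Defs
  imports "HOL-Analysis.Analysis" "HOL-Algebra.Coset"
begin

text \<open>As every topological group is assumed to be Hausdorff, the separation axiom is part of the
  locale.\<close>

locale topological_group = group G for G (structure) +
  fixes T :: "'a topology"
  assumes topspace_eq_carrier: "topspace T = carrier G"
    and continuous_mult: "continuous_map (prod_topology T T) T (\<lambda>(x, y). x \<otimes> y)"
    and continuous_inv: "continuous_map T T (\<lambda>x. inv x)"
    and Hausdorff: "Hausdorff_space T"

definition unit_neighbourhoods :: "('a, 'm) monoid_scheme \<Rightarrow> 'a topology \<Rightarrow> 'a set set" where
  "unit_neighbourhoods G T =
     {U. U \<subseteq> carrier G \<and> (\<exists>V. openin T V \<and> \<one>\<^bsub>G\<^esub> \<in> V \<and> V \<subseteq> U)}"

definition omega_narrow :: "('a, 'm) monoid_scheme \<Rightarrow> 'a topology \<Rightarrow> bool" where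
  "omega_narrow G T \<longleftrightarrow>
     (\<forall>U \<in> unit_neighbourhoods G T.
        \<exists>C. C \<subseteq> carrier G \<and> countable C \<and> carrier G = C <#>\<^bsub>G\<^esub> U)"

definition countable_pseudocharacter :: "'a topology \<Rightarrow> bool" where
  "countable_pseudocharacter T \<longleftrightarrow>
     (\<forall>x \<in> topspace T. \<exists>\<U>. countable \<U> \<and> (\<forall>U \<in> \<U>. openin T U) \<and> \<Inter>\<U> = {x})"

definition two_sided_uniformity ::
    "('a, 'm) monoid_scheme \<Rightarrow> 'a topology \<Rightarrow> ('a \<times> 'a) filter" where
  "two_sided_uniformity G T =
     (INF U \<in> unit_neighbourhoods G T.
        principal {(x, y). x \<in> carrier G \<and> y \<in> carrier G \<and>
          y \<in> (x <#\<^bsub>G\<^esub> U) \<inter> (U #>\<^bsub>G\<^esub> x)})"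

text \<open>Completeness is expressed by Cauchy filters, in the same way as \<^const>\<open>cauchy_filter\<close> and
  \<^const>\<open>complete\<close> do it for the type class of uniform spaces. Convergence is taken in \<open>T\<close>, which
  is the topology induced by the two-sided uniformity. Every
  entourage lies in \<open>carrier G \<times> carrier G\<close>, so a Cauchy filter automatically lives on the carrier.\<close>

definition complete_group :: "('a, 'm) monoid_scheme \<Rightarrow> 'a topology \<Rightarrow> bool" where
  "complete_group G T \<longleftrightarrow>
     (\<forall>F. F \<noteq> bot \<and> F \<times>\<^sub>F F \<le> two_sided_uniformity G T \<longrightarrow>
        (\<exists>x \<in> carrier G. F \<le> nhdsin T x))"

text \<open>HOL does not allow quantification over types inside a formula. The type argument of the next
  two definitions is the universe from which the carriers of the target groups are taken.\<close>

definition iTG_closed ::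
    "'b itself \<Rightarrow> ('a, 'm) monoid_scheme \<Rightarrow> 'a topology \<Rightarrow> bool" where
  "iTG_closed (_ :: 'b itself) G T \<longleftrightarrow>
     (\<forall>(H :: 'b monoid) S f.
        topological_group H S \<and> f \<in> hom G H \<and> inj_on f (carrier G) \<and> continuous_map T S f \<longrightarrow>
        closedin S (f ` carrier G))"

definition minimal_group ::
    "'b itself \<Rightarrow> ('a, 'm) monoid_scheme \<Rightarrow> 'a topology \<Rightarrow> bool" where
  "minimal_group (_ :: 'b itself) G T \<longleftrightarrow>
     (\<forall>(H :: 'b monoid) S h.
        topological_group H S \<and> h \<in> hom G H \<and> bij_betw h (carrier G) (carrier H) \<and>
        continuous_map T S h \<longrightarrow>
        open_map T S h)"

text \<open>The universe used for a group with elements of type \<open>'a\<close>. The parameter \<open>'b\<close> is arbitrary,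
  hence so are the target groups. The summand \<open>'a set set\<close> makes the universe large enough: if
  \<open>f\<close> is a map from a group on \<open>'a\<close> into a Hausdorff group, each point \<open>y\<close> of the closure of the
  image is determined by the set of all preimages of neighbourhoods of \<open>y\<close>, so the
  closure has a copy with carrier in \<open>'a set set\<close>. Consequently neither of the two notions above
  depends on the choice of \<open>'b\<close>.\<close>

type_synonym ('a, 'b) universe = "'a set set + 'b"

end

theory Submission
  imports Defs
begin

text \<open>
  A complete minimal group is closed under an injective continuous homomorphism, since minimality
  makes the homomorphism an embedding and a complete subgroup of a Hausdorff group is closed.

  For the converse, let \<open>X\<close> be \<open>i:TG\<close>-closed. Then \<open>X\<close> is closed in the completion of any coarser
  Hausdorff group topology \<open>\<sigma>\<close>, so every such \<open>\<sigma>\<close> is complete. This reduces everything to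
  comparing complete topologies, which is what an open mapping theorem does: if two comparable complete group
  topologies both have a countable base at the unit, and the finer one is \<open>\<omega>\<close>-narrow, they are
  equal (\<open>open_mapping\<close>). Its proof has two halves. Narrowness and the Baire property of the coarser
  topology make every finely open set \<open>A\<close> nearly open, that is, contained in the coarse interior of its
  coarse closure. The completeness of the finer topology then shows, by an argument of Weston,
  that nearly open sets have the same closure in both topologies, and regularity finishes the proof.

  Coarser topologies with a countable base are plentiful. In an \<open>\<omega>\<close>-narrow group any countable
  family of neighbourhoods of the unit is contained in a countable family that is a base of a group
  topology, because conjugation by a whole group has to be controlled only on a countable set
  (\<open>omega_narrow_countable_group_base\<close>). Countable pseudocharacter makes that topology Hausdorff.

  Now let \<open>\<rho>\<close> be a Hausdorff topology of this kind below the topology \<open>\<tau>\<close> of \<open>X\<close>. For each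
  \<open>\<tau>\<close>-neighbourhood \<open>U\<close> of the unit there is a finer one \<open>\<rho>\<^sub>U\<close> in which \<open>U\<close> is a neighbourhood.
  Both are complete, so \<open>\<rho> = \<rho>\<^sub>U\<close>, and hence \<open>\<tau> = \<rho>\<close> has a countable base at the unit. It follows
  that every coarser Hausdorff group topology \<open>\<sigma>\<close> has countable pseudocharacter as well. Applying the
  construction to \<open>\<sigma>\<close> yields a complete topology with a countable base below \<open>\<sigma>\<close>, which the open mapping
  theorem identifies with \<open>\<tau>\<close>. So \<open>\<sigma> = \<tau>\<close>, which is minimality.
\<close>

section \<open>Neighbourhoods in a topological group\<close>

lemma (in group) inv_mult_cancel:
  "\<lbrakk>x \<in> carrier G; y \<in> carrier G\<rbrakk> \<Longrightarrow> inv x \<otimes> (x \<otimes> y) = y"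
  "\<lbrakk>x \<in> carrier G; y \<in> carrier G\<rbrakk> \<Longrightarrow> x \<otimes> (inv x \<otimes> y) = y"
  by (simp_all add: m_assoc[symmetric])

lemmas (in group) group_normalize = m_assoc inv_mult_group inv_mult_cancel

text \<open>Open neighbourhoods of the unit; unlike \<^const>\<open>unit_neighbourhoods\<close> this involves no
  existential quantifier over an open subset.\<close>

definition unit_nbhd :: "('a, 'm) monoid_scheme \<Rightarrow> 'a topology \<Rightarrow> 'a set \<Rightarrow> bool" where
  "unit_nbhd G T U \<longleftrightarrow> openin T U \<and> \<one>\<^bsub>G\<^esub> \<in> U"

context topological_group
begin

lemma open_carrier: "openin T A \<Longrightarrow> x \<in> A \<Longrightarrow> x \<in> carrier G"
  using openin_subset topspace_eq_carrier by blast

lemma unit_nbhd_carrier: "unit_nbhd G T U \<Longrightarrow> x \<in> U \<Longrightarrow> x \<in> carrier G"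
  using open_carrier unfolding unit_nbhd_def by blast

lemma unit_nbhd_Int: "unit_nbhd G T U \<Longrightarrow> unit_nbhd G T V \<Longrightarrow> unit_nbhd G T (U \<inter> V)"
  by (auto simp: unit_nbhd_def)

lemma unit_nbhd_top: "unit_nbhd G T (carrier G)"
  using topspace_eq_carrier by (metis one_closed openin_topspace unit_nbhd_def)

lemma continuous_mult_pair:
  "continuous_map Z T f \<Longrightarrow> continuous_map Z T g \<Longrightarrow> continuous_map Z T (\<lambda>z. f z \<otimes> g z)"
  using continuous_map_compose[of Z "prod_topology T T" "\<lambda>z. (f z, g z)" T "\<lambda>(x, y). x \<otimes> y"]
    continuous_mult by (simp add: continuous_map_pairedI o_def)

lemma continuous_translation:
  assumes "a \<in> carrier G" "b \<in> carrier G"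
  shows "continuous_map T T (\<lambda>x. a \<otimes> x \<otimes> b)"
  by (intro continuous_mult_pair) (use assms in \<open>auto simp: topspace_eq_carrier\<close>)

lemma continuous_left_translation:
  assumes "a \<in> carrier G"
  shows "continuous_map T T (\<lambda>x. a \<otimes> x)"
  by (intro continuous_mult_pair) (use assms in \<open>auto simp: topspace_eq_carrier\<close>)

lemma open_left_translation:
  assumes "a \<in> carrier G" "openin T A"
  shows "openin T {x \<in> carrier G. a \<otimes> x \<in> A}"
  using openin_continuous_map_preimage[OF continuous_left_translation[OF assms(1)] assms(2)]
  by (simp add: topspace_eq_carrier)

lemma unit_nbhd_conj:
  assumes "unit_nbhd G T U" "x \<in> carrier G"
  shows "\<exists>V. unit_nbhd G T V \<and> (\<forall>v\<in>V. inv x \<otimes> v \<otimes> x \<in> U)"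
proof (intro exI conjI)
  let ?V = "{y \<in> topspace T. inv x \<otimes> y \<otimes> x \<in> U}"
  show "unit_nbhd G T ?V"
    using openin_continuous_map_preimage[OF continuous_translation[of "inv x" x], of U] assms
    by (auto simp: unit_nbhd_def topspace_eq_carrier)
qed auto

lemma unit_nbhd_mult:
  assumes "unit_nbhd G T U"
  shows "\<exists>V. unit_nbhd G T V \<and> (\<forall>x\<in>V. \<forall>y\<in>V. x \<otimes> y \<in> U)"
proof -
  let ?S = "{z \<in> topspace (prod_topology T T). (\<lambda>(x,y). x \<otimes> y) z \<in> U}"
  have "openin (prod_topology T T) ?S"
    by (rule openin_continuous_map_preimage[OF continuous_mult]) (use assms in \<open>simp add: unit_nbhd_def\<close>)
  moreover have "(\<one>, \<one>) \<in> ?S"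
    using assms by (auto simp: unit_nbhd_def topspace_eq_carrier)
  ultimately have "\<exists>A B. openin T A \<and> openin T B \<and> \<one> \<in> A \<and> \<one> \<in> B \<and> A \<times> B \<subseteq> ?S"
    by (rule openin_prod_topology_alt[THEN iffD1, rule_format])
  then obtain A B where "openin T A" "openin T B" "\<one> \<in> A" "\<one> \<in> B" "A \<times> B \<subseteq> ?S"
    by (elim exE conjE)
  then show ?thesis
    by (intro exI[of _ "A \<inter> B"]) (auto simp: unit_nbhd_def)
qed

lemma unit_nbhd_inv:
  assumes "unit_nbhd G T U"
  shows "unit_nbhd G T {x \<in> carrier G. inv x \<in> U}"
  using openin_continuous_map_preimage[OF continuous_inv, of U] assms
  by (auto simp: unit_nbhd_def topspace_eq_carrier)

text \<open>One symmetric neighbourhood serves all products of up to three factors, which is as many as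
  the arguments below need.\<close>

lemma unit_nbhd_symmetric_cube:
  assumes "unit_nbhd G T U"
  shows "\<exists>V. unit_nbhd G T V \<and> V \<subseteq> U \<and> (\<forall>x\<in>V. inv x \<in> V) \<and>
    (\<forall>x\<in>V. \<forall>y\<in>V. x \<otimes> y \<in> U) \<and> (\<forall>x\<in>V. \<forall>y\<in>V. \<forall>z\<in>V. x \<otimes> y \<otimes> z \<in> U)"
proof -
  obtain V where V: "unit_nbhd G T V" "\<And>x y. x\<in>V \<Longrightarrow> y\<in>V \<Longrightarrow> x \<otimes> y \<in> U"
    using unit_nbhd_mult[OF assms] by blast
  obtain W where W: "unit_nbhd G T W" "\<And>x y. x\<in>W \<Longrightarrow> y\<in>W \<Longrightarrow> x \<otimes> y \<in> V"
    using unit_nbhd_mult[OF V(1)] by blast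
  define Z where "Z = W \<inter> {x \<in> carrier G. inv x \<in> W}"
  have Z: "unit_nbhd G T Z"
    unfolding Z_def by (intro unit_nbhd_Int W unit_nbhd_inv)
  have 1: "\<one> \<in> W" "\<one> \<in> V" using V W by (auto simp: unit_nbhd_def)
  have ZV: "x \<in> V" if "x \<in> Z" for x
    using W(2)[of x \<one>] 1 that unit_nbhd_carrier[OF W(1), of x] by (auto simp: Z_def)
  have VU: "x \<in> U" if "x \<in> V" for x
    using V(2)[of x \<one>] 1 that unit_nbhd_carrier[OF V(1), of x] by auto
  show ?thesis
    by (rule exI[of _ Z]) (use Z ZV VU V(2) W(2) in \<open>auto simp: Z_def\<close>)
qed

lemma open_translate:
  assumes "unit_nbhd G T U" "x \<in> carrier G"
  shows "openin T {y \<in> carrier G. inv x \<otimes> y \<in> U}" "x \<in> {y \<in> carrier G. inv x \<otimes> y \<in> U}"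
  using assms open_left_translation[of "inv x" U] by (auto simp: unit_nbhd_def)

lemma open_contains_translate:
  assumes "openin T A" "x \<in> A"
  shows "\<exists>U. unit_nbhd G T U \<and> (\<forall>u\<in>U. x \<otimes> u \<in> A)"
proof (intro exI conjI)
  have "x \<in> carrier G" using assms open_carrier by blast
  then show "unit_nbhd G T {u \<in> carrier G. x \<otimes> u \<in> A}"
    using assms open_left_translation[of x A] by (auto simp: unit_nbhd_def)
qed auto

lemma unit_nbhd_separates:
  assumes "x \<in> carrier G" "x \<noteq> \<one>"
  shows "\<exists>U. unit_nbhd G T U \<and> x \<notin> U"
proof -
  obtain A B where "openin T A" "openin T B" "\<one> \<in> A" "x \<in> B" "disjnt A B"
    using Hausdorff assms unfolding Hausdorff_space_def topspace_eq_carrier by blast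
  then show ?thesis by (auto simp: unit_nbhd_def disjnt_def)
qed

lemma closure_of_meets:
  "y \<in> Z closure_of B \<Longrightarrow> openin Z A \<Longrightarrow> y \<in> A \<Longrightarrow> \<exists>z. z \<in> B \<and> z \<in> A"
  by (auto simp: in_closure_of)

text \<open>The closure of \<open>xV\<close> lies in \<open>x V V\<^sup>-\<^sup>1\<close>, so a small translate has its closure in a given
  neighbourhood.\<close>

lemma open_shrink_closure:
  assumes "openin T A" "x \<in> A"
  shows "\<exists>B. openin T B \<and> x \<in> B \<and> T closure_of B \<subseteq> A"
proof -
  have x: "x \<in> carrier G" using assms open_carrier by blast
  obtain U where U: "unit_nbhd G T U" "\<And>u. u\<in>U \<Longrightarrow> x \<otimes> u \<in> A"
    using open_contains_translate[OF assms] by blast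
  obtain V where V: "unit_nbhd G T V" "\<And>v. v\<in>V \<Longrightarrow> inv v \<in> V"
    "\<And>v w. v\<in>V \<Longrightarrow> w\<in>V \<Longrightarrow> v \<otimes> w \<in> U"
    using unit_nbhd_symmetric_cube[OF U(1)] by metis
  let ?B = "{y \<in> carrier G. inv x \<otimes> y \<in> V}"
  have "y \<in> A" if y: "y \<in> T closure_of ?B" for y
  proof -
    have yc: "y \<in> carrier G" using y topspace_eq_carrier by (simp add: in_closure_of)
    obtain z where z: "z \<in> ?B" "z \<in> carrier G" "inv y \<otimes> z \<in> V"
      using closure_of_meets[OF y open_translate[OF V(1) yc]] by blast
    have "(inv x \<otimes> z) \<otimes> inv (inv y \<otimes> z) \<in> U"
      using z V by blast
    moreover have "(inv x \<otimes> z) \<otimes> inv (inv y \<otimes> z) = inv x \<otimes> y"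
      using x yc z by (simp add: group_normalize)
    ultimately show ?thesis using U(2)[of "inv x \<otimes> y"] x yc by (simp add: group_normalize)
  qed
  then show ?thesis using open_translate[OF V(1) x] by blast
qed

text \<open>Group topologies are compared at the unit, and so is the continuity of homomorphisms, because
  translations carry the unit to any other point.\<close>

lemma group_topology_le:
  assumes "\<And>U. unit_nbhd G S U \<Longrightarrow> \<exists>V. unit_nbhd G T V \<and> V \<subseteq> U"
    and "topological_group G S" "openin S A"
  shows "openin T A"
proof (subst openin_subopen, intro ballI)
  interpret S: topological_group G S by fact
  fix x assume x: "x \<in> A"
  then have xc: "x \<in> carrier G" using S.open_carrier assms(3) by blast
  obtain U where U: "unit_nbhd G S U" "\<And>u. u\<in>U \<Longrightarrow> x \<otimes> u \<in> A"
    using S.open_contains_translate[OF assms(3) x] by blast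
  obtain V where V: "unit_nbhd G T V" "V \<subseteq> U" using assms(1) U(1) by blast
  have "y \<in> A" if "y \<in> carrier G" "inv x \<otimes> y \<in> V" for y
    using U(2)[of "inv x \<otimes> y"] that V(2) xc by (auto simp: group_normalize)
  then show "\<exists>B. openin T B \<and> x \<in> B \<and> B \<subseteq> A"
    using open_translate[OF V(1) xc] by blast
qed

lemma continuous_hom_at_unit:
  assumes "topological_group H S" "f \<in> hom G H"
    and "\<And>W. unit_nbhd H S W \<Longrightarrow> \<exists>V. unit_nbhd G T V \<and> f ` V \<subseteq> W"
  shows "continuous_map T S f"
  unfolding continuous_map_def
proof (intro conjI allI impI)
  interpret S: topological_group H S by fact
  interpret group_hom G H f
    using assms(2) by (simp add: group_hom_def group_hom_axioms_def is_group S.is_group)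
  show "f \<in> topspace T \<rightarrow> topspace S"
    by (auto simp: topspace_eq_carrier S.topspace_eq_carrier)
  fix A assume A: "openin S A"
  show "openin T {x \<in> topspace T. f x \<in> A}"
  proof (subst openin_subopen, intro ballI)
    fix x assume x: "x \<in> {x \<in> topspace T. f x \<in> A}"
    then have xc: "x \<in> carrier G" by (simp add: topspace_eq_carrier)
    obtain W where W: "unit_nbhd H S W" "\<And>w. w\<in>W \<Longrightarrow> f x \<otimes>\<^bsub>H\<^esub> w \<in> A"
      using S.open_contains_translate[OF A] x by blast
    obtain V where V: "unit_nbhd G T V" "f ` V \<subseteq> W" using assms(3) W(1) by blast
    have "f y \<in> A" if "y \<in> carrier G" "inv x \<otimes> y \<in> V" for y
      using W(2)[of "f (inv x \<otimes> y)"] that V(2) xc by (auto simp: S.group_normalize)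
    then show "\<exists>B. openin T B \<and> x \<in> B \<and> B \<subseteq> {x \<in> topspace T. f x \<in> A}"
      using open_translate[OF V(1) xc] by (intro exI conjI) (auto simp: topspace_eq_carrier)
  qed
qed

end

section \<open>Group topologies from a base at the unit\<close>

text \<open>The classical axioms for a neighbourhood base at the unit of a group topology; the last one
  makes left and right translates define the same topology.\<close>

locale group_base = group G for G (structure) +
  fixes \<B> :: "'a set set"
  assumes base_nonempty: "\<B> \<noteq> {}"
    and base_carrier: "U \<in> \<B> \<Longrightarrow> U \<subseteq> carrier G"
    and base_one: "U \<in> \<B> \<Longrightarrow> \<one> \<in> U"
    and base_Int: "U \<in> \<B> \<Longrightarrow> V \<in> \<B> \<Longrightarrow> \<exists>W\<in>\<B>. W \<subseteq> U \<inter> V"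
    and base_mult: "U \<in> \<B> \<Longrightarrow> \<exists>V\<in>\<B>. \<forall>x\<in>V. \<forall>y\<in>V. x \<otimes> y \<in> U"
    and base_inv: "U \<in> \<B> \<Longrightarrow> \<exists>V\<in>\<B>. \<forall>x\<in>V. inv x \<in> U"
    and base_conj: "U \<in> \<B> \<Longrightarrow> g \<in> carrier G \<Longrightarrow> \<exists>V\<in>\<B>. \<forall>x\<in>V. inv g \<otimes> x \<otimes> g \<in> U"

definition group_topology :: "('a, 'm) monoid_scheme \<Rightarrow> 'a set set \<Rightarrow> 'a topology" where
  "group_topology G \<B> = topology (\<lambda>A. A \<subseteq> carrier G \<and>
     (\<forall>x\<in>A. \<exists>U\<in>\<B>. \<forall>y\<in>carrier G. inv\<^bsub>G\<^esub> x \<otimes>\<^bsub>G\<^esub> y \<in> U \<longrightarrow> y \<in> A))"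

context group_base
begin

lemma openin_group_topology:
  "openin (group_topology G \<B>) A \<longleftrightarrow> A \<subseteq> carrier G \<and>
     (\<forall>x\<in>A. \<exists>U\<in>\<B>. \<forall>y\<in>carrier G. inv x \<otimes> y \<in> U \<longrightarrow> y \<in> A)"
proof -
  have "istopology (\<lambda>A. A \<subseteq> carrier G \<and>
     (\<forall>x\<in>A. \<exists>U\<in>\<B>. \<forall>y\<in>carrier G. inv x \<otimes> y \<in> U \<longrightarrow> y \<in> A))"
    unfolding istopology_def
  proof (intro conjI allI impI ballI; (elim conjE)?)
    fix S T x
    assume S: "\<forall>x\<in>S. \<exists>U\<in>\<B>. \<forall>y\<in>carrier G. inv x \<otimes> y \<in> U \<longrightarrow> y \<in> S"
     and T: "\<forall>x\<in>T. \<exists>U\<in>\<B>. \<forall>y\<in>carrier G. inv x \<otimes> y \<in> U \<longrightarrow> y \<in> T" and "x \<in> S \<inter> T"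
    then obtain U V where UV: "U \<in> \<B>" "\<forall>y\<in>carrier G. inv x \<otimes> y \<in> U \<longrightarrow> y \<in> S"
      "V \<in> \<B>" "\<forall>y\<in>carrier G. inv x \<otimes> y \<in> V \<longrightarrow> y \<in> T" by blast
    then obtain W where "W \<in> \<B>" "W \<subseteq> U \<inter> V" using base_Int by blast
    with UV show "\<exists>U\<in>\<B>. \<forall>y\<in>carrier G. inv x \<otimes> y \<in> U \<longrightarrow> y \<in> S \<inter> T" by blast
  next
    fix \<K> x
    assume K: "\<forall>K\<in>\<K>. K \<subseteq> carrier G \<and> (\<forall>x\<in>K. \<exists>U\<in>\<B>. \<forall>y\<in>carrier G. inv x \<otimes> y \<in> U \<longrightarrow> y \<in> K)"
      and "x \<in> \<Union>\<K>"
    then obtain K where "K \<in> \<K>" "x \<in> K" by blast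
    with K obtain U where "U \<in> \<B>" "\<forall>y\<in>carrier G. inv x \<otimes> y \<in> U \<longrightarrow> y \<in> K" by blast
    with \<open>K \<in> \<K>\<close> show "\<exists>U\<in>\<B>. \<forall>y\<in>carrier G. inv x \<otimes> y \<in> U \<longrightarrow> y \<in> \<Union>\<K>" by blast
  qed auto
  then show ?thesis unfolding group_topology_def by (simp add: topology_inverse')
qed

lemma topspace_group_topology: "topspace (group_topology G \<B>) = carrier G"
proof -
  have "openin (group_topology G \<B>) (carrier G)"
    unfolding openin_group_topology using base_nonempty by blast
  moreover have "A \<subseteq> carrier G" if "openin (group_topology G \<B>) A" for A
    using that unfolding openin_group_topology by simp
  ultimately show ?thesis
    unfolding topspace_def by blast
qed

text \<open>Members of the base need not be open. The points with a basic translate inside \<open>xU\<close> form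
  an open set between \<open>{x}\<close> and \<open>xU\<close>.\<close>

lemma group_topology_nbhd:
  assumes U: "U \<in> \<B>" and x: "x \<in> carrier G"
  shows "\<exists>A. openin (group_topology G \<B>) A \<and> x \<in> A \<and> (\<forall>y\<in>A. inv x \<otimes> y \<in> U)"
proof (intro exI conjI ballI)
  let ?A = "{y \<in> carrier G. \<exists>V\<in>\<B>. \<forall>v\<in>V. inv x \<otimes> (y \<otimes> v) \<in> U}"
  show "openin (group_topology G \<B>) ?A"
    unfolding openin_group_topology
  proof (intro conjI ballI)
    fix y assume "y \<in> ?A"
    then obtain V where y: "y \<in> carrier G" and V: "V \<in> \<B>" "\<And>v. v\<in>V \<Longrightarrow> inv x \<otimes> (y \<otimes> v) \<in> U" by blast
    obtain W where W: "W \<in> \<B>" "\<And>v w. v\<in>W \<Longrightarrow> w\<in>W \<Longrightarrow> v \<otimes> w \<in> V"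
      using base_mult[OF V(1)] by blast
    have "z \<in> ?A" if z: "z \<in> carrier G" "inv y \<otimes> z \<in> W" for z
    proof -
      have "inv x \<otimes> (z \<otimes> w) \<in> U" if w: "w \<in> W" for w
      proof -
        have "w \<in> carrier G" using base_carrier W(1) w by blast
        then have "y \<otimes> ((inv y \<otimes> z) \<otimes> w) = z \<otimes> w" using y z by (simp add: group_normalize)
        then show ?thesis using V(2)[OF W(2)[OF z(2) w]] by simp
      qed
      then show ?thesis using z W by blast
    qed
    then show "\<exists>U\<in>\<B>. \<forall>z\<in>carrier G. inv y \<otimes> z \<in> U \<longrightarrow> z \<in> ?A" using W(1) by blast
  qed auto
  have "inv x \<otimes> (x \<otimes> u) \<in> U" if "u \<in> U" for u
    using that base_carrier[OF U] x by (auto simp: group_normalize)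
  then show "x \<in> ?A" using x U by blast
next
  fix y assume "y \<in> {y \<in> carrier G. \<exists>V\<in>\<B>. \<forall>v\<in>V. inv x \<otimes> (y \<otimes> v) \<in> U}"
  then show "inv x \<otimes> y \<in> U" using base_one by (auto dest!: bspec[of _ _ \<one>])
qed

lemma group_topology_group:
  assumes inter: "\<Inter>\<B> = {\<one>}"
  shows "topological_group G (group_topology G \<B>)"
proof (unfold_locales)
  let ?T = "group_topology G \<B>"
  show "topspace ?T = carrier G" by (rule topspace_group_topology)
  show "continuous_map (prod_topology ?T ?T) ?T (\<lambda>(x, y). x \<otimes> y)"
    unfolding continuous_map_def
  proof (intro conjI allI impI)
    fix A assume A: "openin ?T A"
    show "openin (prod_topology ?T ?T)
      {z \<in> topspace (prod_topology ?T ?T). (case z of (x, y) \<Rightarrow> x \<otimes> y) \<in> A}"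
      unfolding openin_prod_topology_alt
    proof (intro allI impI)
      fix x y
      assume "(x, y) \<in> {z \<in> topspace (prod_topology ?T ?T). (case z of (x, y) \<Rightarrow> x \<otimes> y) \<in> A}"
      then have xy: "x \<in> carrier G" "y \<in> carrier G" "x \<otimes> y \<in> A"
        by (auto simp: topspace_group_topology)
      then obtain U where U: "U \<in> \<B>" "\<And>z. z \<in> carrier G \<Longrightarrow> inv (x \<otimes> y) \<otimes> z \<in> U \<Longrightarrow> z \<in> A"
        using A unfolding openin_group_topology by blast
      obtain V where V: "V \<in> \<B>" "\<And>v w. v\<in>V \<Longrightarrow> w\<in>V \<Longrightarrow> v \<otimes> w \<in> U"
        using base_mult[OF U(1)] by blast
      obtain W where W: "W \<in> \<B>" "\<And>v. v\<in>W \<Longrightarrow> inv y \<otimes> v \<otimes> y \<in> V"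
        using base_conj[OF V(1) xy(2)] by blast
      obtain P where P: "openin ?T P" "x \<in> P" "\<And>a. a\<in>P \<Longrightarrow> inv x \<otimes> a \<in> W"
        using group_topology_nbhd[OF W(1) xy(1)] by blast
      obtain Q where Q: "openin ?T Q" "y \<in> Q" "\<And>a. a\<in>Q \<Longrightarrow> inv y \<otimes> a \<in> V"
        using group_topology_nbhd[OF V(1) xy(2)] by blast
      have PQ: "P \<subseteq> carrier G" "Q \<subseteq> carrier G" using P(1) Q(1) openin_group_topology by blast+
      have "a \<otimes> b \<in> A" if ab: "a \<in> P" "b \<in> Q" for a b
      proof -
        have "(inv y \<otimes> (inv x \<otimes> a) \<otimes> y) \<otimes> (inv y \<otimes> b) \<in> U" using V W P Q ab by blast
        moreover have "a \<in> carrier G" "b \<in> carrier G" using PQ ab by auto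
        ultimately show ?thesis using U(2)[of "a \<otimes> b"] xy by (simp add: group_normalize)
      qed
      then show "\<exists>P Q. openin ?T P \<and> openin ?T Q \<and> x \<in> P \<and> y \<in> Q \<and>
         P \<times> Q \<subseteq> {z \<in> topspace (prod_topology ?T ?T). (case z of (x, y) \<Rightarrow> x \<otimes> y) \<in> A}"
        using P Q PQ by (intro exI[of _ P] exI[of _ Q]) (auto simp: topspace_group_topology)
    qed
  qed (auto simp: topspace_group_topology)
  show "continuous_map ?T ?T (\<lambda>x. inv x)"
    unfolding continuous_map_def
  proof (intro conjI allI impI)
    fix A assume A: "openin ?T A"
    show "openin ?T {x \<in> topspace ?T. inv x \<in> A}"
    proof (subst openin_subopen, intro ballI)
      fix x assume "x \<in> {x \<in> topspace ?T. inv x \<in> A}"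
      then have x: "x \<in> carrier G" "inv x \<in> A" by (auto simp: topspace_group_topology)
      then obtain U where U: "U \<in> \<B>" "\<And>z. z \<in> carrier G \<Longrightarrow> inv (inv x) \<otimes> z \<in> U \<Longrightarrow> z \<in> A"
        using A unfolding openin_group_topology by blast
      obtain V where V: "V \<in> \<B>" "\<And>v. v\<in>V \<Longrightarrow> inv v \<in> U"
        using base_inv[OF U(1)] by blast
      obtain W where W: "W \<in> \<B>" "\<And>v. v\<in>W \<Longrightarrow> inv (inv x) \<otimes> v \<otimes> inv x \<in> V"
        using base_conj[OF V(1)] x(1) by (metis inv_closed)
      obtain P where P: "openin ?T P" "x \<in> P" "\<And>a. a\<in>P \<Longrightarrow> inv x \<otimes> a \<in> W"
        using group_topology_nbhd[OF W(1) x(1)] by blast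
      have Pc: "P \<subseteq> carrier G" using P(1) openin_group_topology by blast
      have "inv a \<in> A" if a: "a \<in> P" for a
      proof -
        have "inv (inv (inv x) \<otimes> (inv x \<otimes> a) \<otimes> inv x) \<in> U" using V W P a by blast
        moreover have "a \<in> carrier G" using Pc a by auto
        ultimately show ?thesis using U(2)[of "inv a"] x by (simp add: group_normalize)
      qed
      then show "\<exists>P. openin ?T P \<and> x \<in> P \<and> P \<subseteq> {x \<in> topspace ?T. inv x \<in> A}"
        using P Pc by (intro exI[of _ P]) (auto simp: topspace_group_topology)
    qed
  qed (auto simp: topspace_group_topology)
  show "Hausdorff_space ?T"
    unfolding Hausdorff_space_def topspace_group_topology
  proof (intro allI impI, elim conjE)
    fix x y assume xy: "x \<in> carrier G" "y \<in> carrier G" "x \<noteq> y"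
    then have "inv x \<otimes> y \<noteq> \<one>" by (metis inv_equality inv_inv inv_closed)
    then obtain U where U: "U \<in> \<B>" "inv x \<otimes> y \<notin> U" using inter by blast
    obtain V where V: "V \<in> \<B>" "\<And>v w. v\<in>V \<Longrightarrow> w\<in>V \<Longrightarrow> v \<otimes> w \<in> U"
      using base_mult[OF U(1)] by blast
    obtain W where W: "W \<in> \<B>" "\<And>v. v\<in>W \<Longrightarrow> inv v \<in> V"
      using base_inv[OF V(1)] by blast
    obtain P where P: "openin ?T P" "x \<in> P" "\<And>a. a\<in>P \<Longrightarrow> inv x \<otimes> a \<in> V"
      using group_topology_nbhd[OF V(1) xy(1)] by blast
    obtain Q where Q: "openin ?T Q" "y \<in> Q" "\<And>a. a\<in>Q \<Longrightarrow> inv y \<otimes> a \<in> W"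
      using group_topology_nbhd[OF W(1) xy(2)] by blast
    have Pc: "P \<subseteq> carrier G" using P(1) openin_group_topology by blast
    have "False" if a: "a \<in> P" "a \<in> Q" for a
    proof -
      have "(inv x \<otimes> a) \<otimes> inv (inv y \<otimes> a) \<in> U" using V W P Q a by blast
      moreover have "a \<in> carrier G" using Pc a by auto
      ultimately show False using U xy by (simp add: group_normalize)
    qed
    then show "\<exists>P Q. openin ?T P \<and> openin ?T Q \<and> x \<in> P \<and> y \<in> Q \<and> disjnt P Q"
      using P Q by (auto simp: disjnt_def)
  qed
qed

lemma group_topology_base:
  shows "U \<in> \<B> \<Longrightarrow> \<exists>V. unit_nbhd G (group_topology G \<B>) V \<and> V \<subseteq> U"
    and "unit_nbhd G (group_topology G \<B>) V \<Longrightarrow> \<exists>U\<in>\<B>. U \<subseteq> V"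
proof -
  assume U: "U \<in> \<B>"
  obtain A where A: "openin (group_topology G \<B>) A" "\<one> \<in> A" "\<forall>y\<in>A. inv \<one> \<otimes> y \<in> U"
    using group_topology_nbhd[OF U one_closed] by blast
  moreover have "\<one> \<otimes> y = y" if "y \<in> A" for y
    using A(1) that openin_group_topology by auto
  ultimately show "\<exists>V. unit_nbhd G (group_topology G \<B>) V \<and> V \<subseteq> U"
    by (intro exI[of _ A]) (auto simp: unit_nbhd_def)
next
  assume "unit_nbhd G (group_topology G \<B>) V"
  then obtain U where "U \<in> \<B>" "\<forall>y\<in>carrier G. inv \<one> \<otimes> y \<in> U \<longrightarrow> y \<in> V"
    unfolding unit_nbhd_def openin_group_topology by blast
  moreover from this have "U \<subseteq> carrier G" using base_carrier by blast
  ultimately show "\<exists>U\<in>\<B>. U \<subseteq> V" by (intro bexI[of _ U]) auto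
qed

end

section \<open>Completeness\<close>

text \<open>Smallness of order \<open>U\<close> in the two-sided uniformity.\<close>

definition small_set :: "('a, 'm) monoid_scheme \<Rightarrow> 'a set \<Rightarrow> 'a set \<Rightarrow> bool" where
  "small_set G U A \<longleftrightarrow> A \<subseteq> carrier G \<and>
     (\<forall>x\<in>A. \<forall>y\<in>A. inv\<^bsub>G\<^esub> x \<otimes>\<^bsub>G\<^esub> y \<in> U \<and> y \<otimes>\<^bsub>G\<^esub> inv\<^bsub>G\<^esub> x \<in> U)"

definition countable_unit_base :: "('a, 'm) monoid_scheme \<Rightarrow> 'a topology \<Rightarrow> (nat \<Rightarrow> 'a set) \<Rightarrow> bool" where
  "countable_unit_base G T U \<longleftrightarrow>
     (\<forall>n. unit_nbhd G T (U n)) \<and> (\<forall>V. unit_nbhd G T V \<longrightarrow> (\<exists>n. U n \<subseteq> V))"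

context topological_group
begin

lemma unit_nbhd_imp_neighbourhood: "unit_nbhd G T V \<Longrightarrow> V \<in> unit_neighbourhoods G T"
  using unit_nbhd_carrier by (auto simp: unit_neighbourhoods_def unit_nbhd_def)

lemma Cauchy_iff_small_sets:
  "F \<times>\<^sub>F F \<le> two_sided_uniformity G T \<longleftrightarrow>
     (\<forall>U. unit_nbhd G T U \<longrightarrow> (\<exists>A. (\<forall>\<^sub>F x in F. x \<in> A) \<and> small_set G U A))"
proof (intro iffI allI impI)
  fix U assume F: "F \<times>\<^sub>F F \<le> two_sided_uniformity G T" and U: "unit_nbhd G T U"
  let ?E = "{(x, y). x \<in> carrier G \<and> y \<in> carrier G \<and> y \<in> (x <# U) \<inter> (U #> x)}"
  have "F \<times>\<^sub>F F \<le> principal ?E"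
    using F unit_nbhd_imp_neighbourhood[OF U] unfolding two_sided_uniformity_def le_INF_iff by blast
  then have "\<forall>\<^sub>F z in F \<times>\<^sub>F F. z \<in> ?E" by (simp add: le_principal)
  then obtain P Q where P: "eventually P F" and Q: "eventually Q F"
    and PQ: "\<And>x y. P x \<Longrightarrow> Q y \<Longrightarrow> (x, y) \<in> ?E"
    unfolding eventually_prod_filter by blast
  show "\<exists>A. (\<forall>\<^sub>F x in F. x \<in> A) \<and> small_set G U A"
  proof (intro exI conjI)
    show "\<forall>\<^sub>F x in F. x \<in> {x. P x \<and> Q x}" using P Q by (simp add: eventually_conj)
    have "x \<in> carrier G \<and> inv x \<otimes> y \<in> U \<and> y \<otimes> inv x \<in> U" if xy: "P x" "Q y" for x y
    proof -
      have c: "x \<in> carrier G" "y \<in> carrier G" using PQ[OF xy] by auto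
      obtain u v where "u \<in> U" "v \<in> U" "y = x \<otimes> u" "y = v \<otimes> x"
        using PQ[OF xy] by (auto simp: l_coset_def r_coset_def)
      moreover from this have "u \<in> carrier G" "v \<in> carrier G" using unit_nbhd_carrier[OF U] by auto
      moreover from this have "inv x \<otimes> (x \<otimes> u) = u" "v \<otimes> x \<otimes> inv x = v"
        using c by (simp_all add: group_normalize)
      ultimately show ?thesis using c by metis
    qed
    then show "small_set G U {x. P x \<and> Q x}" by (auto simp: small_set_def)
  qed
next
  assume small: "\<forall>U. unit_nbhd G T U \<longrightarrow> (\<exists>A. (\<forall>\<^sub>F x in F. x \<in> A) \<and> small_set G U A)"
  show "F \<times>\<^sub>F F \<le> two_sided_uniformity G T"
    unfolding two_sided_uniformity_def le_INF_iff
  proof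
    fix U assume "U \<in> unit_neighbourhoods G T"
    then obtain V where V: "unit_nbhd G T V" "V \<subseteq> U"
      by (auto simp: unit_neighbourhoods_def unit_nbhd_def)
    obtain A where A: "\<forall>\<^sub>F x in F. x \<in> A" "small_set G V A" using small V(1) by blast
    have "y \<in> (x <# U) \<inter> (U #> x)" if "x \<in> A" "y \<in> A" for x y
    proof -
      have c: "x \<in> carrier G" "y \<in> carrier G" using that A by (auto simp: small_set_def)
      have "inv x \<otimes> y \<in> U" "y \<otimes> inv x \<in> U" using that A V by (auto simp: small_set_def)
      moreover have "x \<otimes> (inv x \<otimes> y) = y" "y \<otimes> inv x \<otimes> x = y"
        using c by (simp_all add: group_normalize)
      ultimately show ?thesis unfolding l_coset_def r_coset_def by force
    qed
    then have "\<forall>\<^sub>F z in F \<times>\<^sub>F F.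
      z \<in> {(x, y). x \<in> carrier G \<and> y \<in> carrier G \<and> y \<in> (x <# U) \<inter> (U #> x)}"
      unfolding eventually_prod_filter
      by (intro exI[of _ "\<lambda>x. x \<in> A"]) (use A in \<open>auto simp: small_set_def\<close>)
    then show "F \<times>\<^sub>F F \<le> principal {(x, y). x \<in> carrier G \<and> y \<in> carrier G \<and> y \<in> (x <# U) \<inter> (U #> x)}"
      by (simp add: le_principal)
  qed
qed

lemma small_set_mono: "small_set G U A \<Longrightarrow> B \<subseteq> A \<Longrightarrow> small_set G U B"
  by (auto simp: small_set_def)

lemma open_shrink_small:
  assumes "openin T A" "x \<in> A" "unit_nbhd G T U"
  shows "\<exists>B. openin T B \<and> x \<in> B \<and> B \<subseteq> A \<and> T closure_of B \<subseteq> A \<and> small_set G U B"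
proof -
  have x: "x \<in> carrier G" using assms open_carrier by blast
  obtain W where W: "unit_nbhd G T W" "\<And>w. w\<in>W \<Longrightarrow> inv (inv x) \<otimes> w \<otimes> inv x \<in> U"
    using unit_nbhd_conj[OF assms(3)] x by (metis inv_closed)
  obtain V where V: "unit_nbhd G T V" "\<And>v. v\<in>V \<Longrightarrow> inv v \<in> V"
    "\<And>v w. v\<in>V \<Longrightarrow> w\<in>V \<Longrightarrow> v \<otimes> w \<in> U \<inter> W"
    using unit_nbhd_symmetric_cube[OF unit_nbhd_Int[OF assms(3) W(1)]] by metis
  let ?C = "{y \<in> carrier G. inv x \<otimes> y \<in> V}"
  obtain B where B: "openin T B" "x \<in> B" "T closure_of B \<subseteq> A"
    using open_shrink_closure[OF assms(1,2)] by blast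
  have "small_set G U ?C"
    unfolding small_set_def
  proof (intro conjI ballI)
    fix y z assume yz: "y \<in> ?C" "z \<in> ?C"
    have "inv (inv x \<otimes> y) \<otimes> (inv x \<otimes> z) \<in> U"
      using V yz by blast
    then show "inv y \<otimes> z \<in> U" using x yz by (simp add: group_normalize)
    have "inv (inv x) \<otimes> ((inv x \<otimes> z) \<otimes> inv (inv x \<otimes> y)) \<otimes> inv x \<in> U"
      using V W yz by blast
    then show "z \<otimes> inv y \<in> U" using x yz by (simp add: group_normalize)
  qed auto
  moreover have "T closure_of (B \<inter> ?C) \<subseteq> A"
    using B(3) closure_of_mono[of "B \<inter> ?C" B T] by blast
  moreover have "B \<subseteq> T closure_of B" using B(1) by (simp add: closure_of_subset openin_subset)
  ultimately show ?thesis
    using B open_translate[OF V(1) x] small_set_mono[of U ?C "B \<inter> ?C"]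
    by (intro exI[of _ "B \<inter> ?C"]) auto
qed

text \<open>Cantor's intersection principle: the sets \<open>A n\<close> form a base of a Cauchy filter. All uses of
  completeness for topologies with a countable base go through it.\<close>

lemma complete_nested_sets:
  assumes "complete_group G T" "countable_unit_base G T U"
    and dec: "\<And>n. A (Suc n) \<subseteq> A n" and ne: "\<And>n. A n \<noteq> {}"
    and small: "\<And>n. small_set G (U n) (A (Suc n))"
  obtains x where "x \<in> carrier G" "\<And>n. x \<in> T closure_of (A n)"
    "\<And>B. openin T B \<Longrightarrow> x \<in> B \<Longrightarrow> \<exists>n. A n \<subseteq> B"
proof -
  have anti: "A n \<subseteq> A m" if "m \<le> n" for m n using lift_Suc_antimono_le[of A, OF dec that] .
  define F where "F = (INF n. principal (A n))"
  have F: "eventually P F \<longleftrightarrow> (\<exists>n. \<forall>x\<in>A n. P x)" for P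
    unfolding F_def
  proof (subst eventually_INF_base)
    fix m n :: nat
    show "\<exists>k\<in>UNIV. principal (A k) \<le> inf (principal (A m)) (principal (A n))"
      using anti[of m "max m n"] anti[of n "max m n"] by (intro bexI[of _ "max m n"]) auto
  qed (auto simp: eventually_principal)
  have "F \<noteq> bot" unfolding trivial_limit_def F using ne by blast
  moreover have "F \<times>\<^sub>F F \<le> two_sided_uniformity G T"
    unfolding Cauchy_iff_small_sets
  proof (intro allI impI)
    fix V assume "unit_nbhd G T V"
    then obtain n where "U n \<subseteq> V" using assms(2) by (auto simp: countable_unit_base_def)
    then show "\<exists>A. (\<forall>\<^sub>F x in F. x \<in> A) \<and> small_set G V A"
      using small[of n] F by (intro exI[of _ "A (Suc n)"]) (auto simp: small_set_def)
  qed
  ultimately obtain x where x: "x \<in> carrier G" "F \<le> nhdsin T x"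
    using assms(1) unfolding complete_group_def by blast
  have lim: "\<exists>n. A n \<subseteq> B" if B: "openin T B" "x \<in> B" for B
  proof -
    have "\<forall>\<^sub>F y in nhdsin T x. y \<in> B" using B by (auto simp: eventually_nhdsin)
    then have "\<forall>\<^sub>F y in F. y \<in> B" using x(2) by (simp add: filter_leD)
    then show ?thesis unfolding F by blast
  qed
  have "x \<in> T closure_of (A n)" for n
    unfolding in_closure_of
  proof (intro conjI allI impI)
    fix B assume "x \<in> B \<and> openin T B"
    then obtain m where "A m \<subseteq> B" using lim by blast
    then show "\<exists>y. y \<in> A n \<and> y \<in> B"
      using ne[of "max m n"] anti[of m "max m n"] anti[of n "max m n"] by auto
  qed (use x topspace_eq_carrier in auto)
  then show ?thesis using that x(1) lim by blast
qed

text \<open>The usual proof of the Baire category theorem: if no \<open>K n\<close> had interior points, nested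
  open sets could avoid each \<open>K n\<close> in turn, and a point in all their closures would lie in no \<open>K n\<close>.\<close>

lemma complete_Baire:
  assumes "complete_group G T" "countable_unit_base G T U"
    and closed: "\<And>n::nat. closedin T (K n)" and cover: "carrier G \<subseteq> (\<Union>n. K n)"
  shows "\<exists>n A. openin T A \<and> A \<noteq> {} \<and> A \<subseteq> K n"
proof (rule ccontr)
  assume no: "\<nexists>n A. openin T A \<and> A \<noteq> {} \<and> A \<subseteq> K n"
  define P where "P = (\<lambda>(n::nat) A. openin T A \<and> A \<noteq> {})"
  define Q where "Q = (\<lambda>n A B. B \<subseteq> A \<and> T closure_of B \<subseteq> A - K n \<and> small_set G (U n) B)"
  have base: "\<exists>A. P 0 A" unfolding P_def using topspace_eq_carrier one_closed openin_topspace by blast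
  have step: "\<exists>B. P (Suc n) B \<and> Q n A B" if A: "P n A" for n A
  proof -
    have 1: "openin T (A - K n)" using A closed unfolding P_def by (simp add: openin_diff)
    obtain x where 2: "x \<in> A - K n" using no A unfolding P_def by blast
    have 3: "unit_nbhd G T (U n)" using assms(2) by (simp add: countable_unit_base_def)
    from open_shrink_small[OF 1 2 3] obtain B where "openin T B" "x \<in> B" "B \<subseteq> A - K n"
      "T closure_of B \<subseteq> A - K n" "small_set G (U n) B" by blast
    then show ?thesis unfolding P_def Q_def by blast
  qed
  obtain A where A: "\<And>n. P n (A n)" "\<And>n. Q n (A n) (A (Suc n))"
    using dependent_nat_choice[of P Q, OF base step] by blast
  obtain x where x: "x \<in> carrier G" "\<And>n. x \<in> T closure_of (A n)"
  proof (rule complete_nested_sets[OF assms(1,2)])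
    show "A (Suc n) \<subseteq> A n" "A n \<noteq> {}" "small_set G (U n) (A (Suc n))" for n
      using A(1)[of n] A(2)[of n] unfolding P_def Q_def by auto
  qed blast
  have "x \<notin> K n" for n using x(2)[of "Suc n"] A(2)[of n] unfolding Q_def by blast
  then show False using cover x(1) by blast
qed

section \<open>An open mapping theorem\<close>

text \<open>Countably many translates of a neighbourhood cover the group, so by Baire the closure of one
  of them in the coarser topology has an interior point, which a translation moves to any place.\<close>

lemma nearly_open:
  assumes S: "topological_group G S" and "omega_narrow G T"
    and "complete_group G S" "countable_unit_base G S US"
    and A: "openin T A" "x \<in> A"
  shows "x \<in> S interior_of (S closure_of A)"
proof -
  interpret S: topological_group G S by fact
  have x: "x \<in> carrier G" using A open_carrier by blast
  obtain W where W: "unit_nbhd G T W" "\<And>w. w\<in>W \<Longrightarrow> x \<otimes> w \<in> A"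
    using open_contains_translate[OF A] by blast
  obtain V where V: "unit_nbhd G T V" "\<And>v. v\<in>V \<Longrightarrow> inv v \<in> V"
    "\<And>v w. v\<in>V \<Longrightarrow> w\<in>V \<Longrightarrow> v \<otimes> w \<in> W"
    using unit_nbhd_symmetric_cube[OF W(1)] by metis
  obtain C where C: "C \<subseteq> carrier G" "countable C" "carrier G = C <#> V"
    using assms(2) unit_nbhd_imp_neighbourhood[OF V(1)] unfolding omega_narrow_def by blast
  have "C \<noteq> {}" using C(3) one_closed by (auto simp: set_mult_def)
  define K where "K = (\<lambda>c. S closure_of {c \<otimes> v | v. v \<in> V})"
  have sub: "{c \<otimes> v | v. v \<in> V} \<subseteq> K c" if "c \<in> C" for c
    unfolding K_def using that C(1) unit_nbhd_carrier[OF V(1)]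
    by (intro closure_of_subset) (auto simp: S.topspace_eq_carrier)
  have "\<exists>n B. openin S B \<and> B \<noteq> {} \<and> B \<subseteq> K (from_nat_into C n)"
  proof (rule S.complete_Baire[OF assms(3,4)])
    show "carrier G \<subseteq> (\<Union>n. K (from_nat_into C n))"
    proof
      fix z assume "z \<in> carrier G"
      then obtain c v where "c \<in> C" "v \<in> V" "z = c \<otimes> v" using C(3) by (auto simp: set_mult_def)
      then have "z \<in> K c" using sub by blast
      then show "z \<in> (\<Union>n. K (from_nat_into C n))"
        using from_nat_into_surj[OF C(2) \<open>c \<in> C\<close>] by blast
    qed
  qed (simp add: K_def)
  then obtain c B where c: "c \<in> C" and B: "openin S B" "B \<noteq> {}" "B \<subseteq> K c"
    using from_nat_into[OF \<open>C \<noteq> {}\<close>] by blast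
  then obtain v where v: "v \<in> V" "c \<otimes> v \<in> B"
    unfolding K_def using closure_of_meets[of _ S _ B] by fastforce
  have cv: "c \<in> carrier G" "v \<in> carrier G" using c C v unit_nbhd_carrier[OF V(1)] by auto
  \<comment> \<open>Left translation by \<open>g\<close> sends \<open>cv\<close> to \<open>x\<close> and \<open>cV\<close> into \<open>x V\<^sup>-\<^sup>1 V\<close>, which lies in \<open>A\<close>.\<close>
  define g where "g = x \<otimes> inv v \<otimes> inv c"
  have g: "g \<in> carrier G" using cv x by (simp add: g_def)
  define P where "P = {y \<in> carrier G. inv g \<otimes> y \<in> B}"
  have "openin S P" unfolding P_def using S.open_left_translation[of "inv g"] g B(1) by simp
  moreover have "x \<in> P" using x v cv by (simp add: P_def g_def group_normalize)
  moreover have "P \<subseteq> S closure_of A"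
  proof
    fix y assume y: "y \<in> P"
    then have yc: "y \<in> carrier G" by (simp add: P_def)
    show "y \<in> S closure_of A"
      unfolding in_closure_of
    proof (intro conjI allI impI)
      fix Q assume Q: "y \<in> Q \<and> openin S Q"
      have 1: "openin S {z \<in> carrier G. g \<otimes> z \<in> Q}" using S.open_left_translation g Q by blast
      have 2: "inv g \<otimes> y \<in> {z \<in> carrier G. g \<otimes> z \<in> Q}"
        using g yc Q by (simp add: group_normalize)
      have 3: "inv g \<otimes> y \<in> S closure_of {c \<otimes> v | v. v \<in> V}"
        using y B(3) by (auto simp: P_def K_def)
      from closure_of_meets[OF 3 1 2] obtain w where w: "w \<in> V" "g \<otimes> (c \<otimes> w) \<in> Q" by blast
      have "w \<in> carrier G" using w unit_nbhd_carrier[OF V(1)] by auto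
      then have "g \<otimes> (c \<otimes> w) = x \<otimes> (inv v \<otimes> w)" using cv x by (simp add: g_def group_normalize)
      moreover have "x \<otimes> (inv v \<otimes> w) \<in> A" using W V v w by blast
      ultimately show "\<exists>y. y \<in> A \<and> y \<in> Q" using w(2) by metis
    qed (use yc S.topspace_eq_carrier in auto)
  qed
  ultimately show ?thesis unfolding interior_of_def by blast
qed

text \<open>Two nested sequences are built, shrinking in \<open>T\<close> around points \<open>a\<close> and \<open>b\<close>, such that
  each term of the second lies in the \<open>S\<close>-closure of the corresponding term of the first. Then \<open>a\<close> and \<open>b\<close> cannot be separated
  in \<open>S\<close>, although the sequences start in sets with disjoint \<open>T\<close>-closures.\<close>

lemma closure_of_coarser_nearly_open:
  assumes S: "topological_group G S"
    and coarser: "\<And>A. openin S A \<Longrightarrow> openin T A"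
    and nearly: "\<And>A x. openin T A \<Longrightarrow> x \<in> A \<Longrightarrow> x \<in> S interior_of (S closure_of A)"
    and T: "complete_group G T" "countable_unit_base G T U"
    and A: "openin T A"
  shows "S closure_of A \<subseteq> T closure_of A"
proof (rule subsetI, rule ccontr)
  interpret S: topological_group G S by fact
  fix y assume y: "y \<in> S closure_of A" "y \<notin> T closure_of A"
  have "y \<in> topspace T - T closure_of A"
    using y by (simp add: topspace_eq_carrier in_closure_of S.topspace_eq_carrier)
  then obtain D where D: "openin T D" "y \<in> D" "T closure_of D \<subseteq> topspace T - T closure_of A"
    using open_shrink_closure[of "topspace T - T closure_of A" y]
    by (meson closedin_closure_of openin_closedin_eq openin_diff openin_topspace)
  \<comment> \<open>The invariant \<open>P\<close> is what near openness restores after both sets have been shrunk.\<close>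
  define P where "P = (\<lambda>(n::nat) (A, D). openin T A \<and> openin T D \<and>
    A \<inter> S interior_of (S closure_of D) \<noteq> {})"
  define Q where "Q = (\<lambda>n (A, D) (A', D'). A' \<subseteq> A \<and> D' \<subseteq> D \<and> small_set G (U n) A' \<and>
    small_set G (U n) D' \<and> D' \<subseteq> S closure_of A')"
  have meet: "B \<inter> S interior_of C \<noteq> {}" if "z \<in> S interior_of C" "z \<in> S closure_of B" for z B C
    using closure_of_meets[OF that(2) openin_interior_of that(1)] by blast
  have U: "unit_nbhd G T (U n)" for n using T(2) by (simp add: countable_unit_base_def)
  have base: "P 0 (A, D)"
    unfolding P_def using A D meet[OF nearly[OF D(1,2)] y(1)] by simp
  have step0: "\<exists>z. P (Suc n) z \<and> Q n x z" if P: "P n x" for n x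
  proof -
    obtain A D where [simp]: "x = (A, D)" by fastforce
    obtain p where p: "p \<in> A" "p \<in> S interior_of (S closure_of D)"
      and open_AD: "openin T A" "openin T D" using P by (auto simp: P_def)
    obtain A' where A': "openin T A'" "p \<in> A'" "A' \<subseteq> A" "small_set G (U n) A'"
      using open_shrink_small[OF open_AD(1) p(1) U] by blast
    have "p \<in> S closure_of D" using p(2) interior_of_subset[of S "S closure_of D"] by (rule rev_subsetD)
    from meet[OF nearly[OF A'(1,2)] this] have "D \<inter> S interior_of (S closure_of A') \<noteq> {}" .
    then obtain q where q: "q \<in> D \<inter> S interior_of (S closure_of A')" by blast
    have "openin T (D \<inter> S interior_of (S closure_of A'))"
      by (intro openin_Int open_AD coarser openin_interior_of)
    from open_shrink_small[OF this q U] obtain D' where D': "openin T D'" "q \<in> D'"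
      "D' \<subseteq> D \<inter> S interior_of (S closure_of A')" "small_set G (U n) D'" by blast
    have sub: "D' \<subseteq> S closure_of A'" using D'(3) interior_of_subset[of S "S closure_of A'"] by blast
    then have "q \<in> S closure_of A'" using D'(2) by (rule subsetD)
    from meet[OF nearly[OF D'(1,2)] this] have "A' \<inter> S interior_of (S closure_of D') \<noteq> {}" .
    with sub show ?thesis
      by (intro exI[of _ "(A', D')"]) (use A' D' in \<open>auto simp: P_def Q_def\<close>)
  qed
  have "\<exists>f. \<forall>n. (P n (f n) \<and> (n = 0 \<longrightarrow> f n = (A, D))) \<and> Q n (f n) (f (Suc n))"
    by (rule dependent_nat_choice[of "\<lambda>n x. P n x \<and> (n = 0 \<longrightarrow> x = (A, D))" Q])
      (use base step0 in auto)
  then obtain f where f: "f 0 = (A, D)" "\<And>n. P n (f n)" "\<And>n. Q n (f n) (f (Suc n))" by blast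
  define AA DD where "AA n = fst (f n)" and "DD n = snd (f n)" for n
  have f_eq: "f n = (AA n, DD n)" for n by (simp add: AA_def DD_def)
  have AD0: "AA 0 = A" "DD 0 = D" using f(1) by (simp_all add: AA_def DD_def)
  have ne: "AA n \<noteq> {}" "DD n \<noteq> {}" for n
  proof -
    show "AA n \<noteq> {}" using f(2)[of n] unfolding f_eq P_def by auto
    show "DD n \<noteq> {}" using f(2)[of n] unfolding f_eq P_def by (auto simp: interior_of_empty)
  qed
  have step: "AA (Suc n) \<subseteq> AA n" "DD (Suc n) \<subseteq> DD n" "small_set G (U n) (AA (Suc n))"
    "small_set G (U n) (DD (Suc n))" "DD (Suc n) \<subseteq> S closure_of (AA (Suc n))" for n
    using f(3)[of n] unfolding f_eq Q_def by auto
  have anti: "AA n \<subseteq> AA m" "DD n \<subseteq> DD m" if "m \<le> n" for m n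
    using lift_Suc_antimono_le[of AA, OF step(1) that] lift_Suc_antimono_le[of DD, OF step(2) that] .
  obtain a where a: "a \<in> carrier G" "\<And>n. a \<in> T closure_of (AA n)"
    "\<And>B. openin T B \<Longrightarrow> a \<in> B \<Longrightarrow> \<exists>n. AA n \<subseteq> B"
    using complete_nested_sets[OF T step(1) ne(1) step(3)] by blast
  obtain b where b: "b \<in> carrier G" "\<And>n. b \<in> T closure_of (DD n)"
    "\<And>B. openin T B \<Longrightarrow> b \<in> B \<Longrightarrow> \<exists>n. DD n \<subseteq> B"
    using complete_nested_sets[OF T step(2) ne(2) step(4)] by blast
  have "a \<noteq> b" using a(2)[of 0] b(2)[of 0] AD0 D(3) by auto
  then obtain P Q where PQ: "openin S P" "openin S Q" "a \<in> P" "b \<in> Q" "disjnt P Q"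
    using S.Hausdorff a(1) b(1) unfolding Hausdorff_space_def S.topspace_eq_carrier by blast
  obtain m where m: "AA m \<subseteq> P" using a(3) PQ coarser by blast
  obtain n where n: "DD n \<subseteq> Q" using b(3) PQ coarser by blast
  define k where "k = max m n"
  have k: "m \<le> Suc k" "n \<le> Suc k" by (auto simp: k_def)
  obtain d where d: "d \<in> DD (Suc k)" using ne by blast
  have "d \<in> Q" "d \<in> S closure_of (AA (Suc k))"
    using d n anti(2)[OF k(2)] step(5)[of k] by auto
  then obtain z where "z \<in> AA (Suc k)" "z \<in> Q" using closure_of_meets[OF _ PQ(2)] by blast
  moreover have "AA (Suc k) \<subseteq> P" using m anti(1)[OF k(1)] by auto
  ultimately show False using PQ(5) by (auto simp: disjnt_def)
qed

text \<open>Near openness puts the interior of the \<open>S\<close>-closure of \<open>B\<close> around each point of \<open>B\<close>, and that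
  closure is no larger than the \<open>T\<close>-closure, which regularity keeps inside a given open set.\<close>

theorem open_mapping:
  assumes S: "topological_group G S" and "omega_narrow G T"
    and coarser: "\<And>A. openin S A \<Longrightarrow> openin T A"
    and cS: "complete_group G S" "countable_unit_base G S US"
    and cT: "complete_group G T" "countable_unit_base G T UT"
    and A: "openin T A"
  shows "openin S A"
proof (subst openin_subopen, intro ballI)
  fix x assume "x \<in> A"
  then obtain B where B: "openin T B" "x \<in> B" "T closure_of B \<subseteq> A"
    using open_shrink_closure[OF A] by blast
  have near: "z \<in> S interior_of (S closure_of C)" if "openin T C" "z \<in> C" for C z
    by (rule nearly_open[OF S assms(2) cS that])
  have "S interior_of (S closure_of B) \<subseteq> A"
    using closure_of_coarser_nearly_open[OF S coarser near cT B(1)] B(3)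
      interior_of_subset[of S "S closure_of B"] by (meson order_trans)
  then show "\<exists>B. openin S B \<and> x \<in> B \<and> B \<subseteq> A"
    using near[OF B(1,2)] openin_interior_of[of S "S closure_of B"] by blast
qed

end

section \<open>The completion of a topological group\<close>

text \<open>
  The completion is built from filters. Filters on a group multiply, and the product is monotone and
  associative. With \<open>\<N>\<close> the neighbourhood filter of the unit, a proper filter \<open>F\<close> is Cauchy for the
  two-sided uniformity iff \<open>F\<^sup>-\<^sup>1 F \<le> \<N>\<close> and \<open>F F\<^sup>-\<^sup>1 \<le> \<N>\<close>. The filter \<open>F \<N>\<close> is then the
  coarsest Cauchy filter equivalent to \<open>F\<close>, and these coarsest filters, characterized by \<open>F \<N> = F\<close>,
  form a group with unit \<open>\<N>\<close>.
\<close>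

lemma filtermap_cong_eventually:
  "\<forall>\<^sub>F x in F. f x = g x \<Longrightarrow> filtermap f F = filtermap g F"
  unfolding filter_eq_iff eventually_filtermap by (auto elim: eventually_elim2)

context group
begin

definition filter_mult :: "'a filter \<Rightarrow> 'a filter \<Rightarrow> 'a filter" (infixl "\<odot>" 70) where
  "F \<odot> E = filtermap (\<lambda>(x, y). x \<otimes> y) (F \<times>\<^sub>F E)"

abbreviation filter_inv :: "'a filter \<Rightarrow> 'a filter" where
  "filter_inv F \<equiv> filtermap (\<lambda>x. inv x) F"

abbreviation on_carrier :: "'a filter \<Rightarrow> bool" where
  "on_carrier F \<equiv> F \<le> principal (carrier G)"

lemma eventually_filter_mult:
  "eventually P (F \<odot> E) \<longleftrightarrow> (\<exists>A B. (\<forall>\<^sub>F x in F. x \<in> A) \<and> (\<forall>\<^sub>F y in E. y \<in> B) \<and>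
     (\<forall>x\<in>A. \<forall>y\<in>B. P (x \<otimes> y)))"
  unfolding filter_mult_def eventually_filtermap eventually_prod_filter
proof (intro iffI; elim exE conjE)
  fix Q R assume "eventually Q F" "eventually R E"
    "\<forall>x y. Q x \<longrightarrow> R y \<longrightarrow> P (case (x, y) of (x, y) \<Rightarrow> x \<otimes> y)"
  then show "\<exists>A B. (\<forall>\<^sub>F x in F. x \<in> A) \<and> (\<forall>\<^sub>F y in E. y \<in> B) \<and> (\<forall>x\<in>A. \<forall>y\<in>B. P (x \<otimes> y))"
    by (intro exI[of _ "Collect Q"] exI[of _ "Collect R"]) auto
next
  fix A B assume "\<forall>\<^sub>F x in F. x \<in> A" "\<forall>\<^sub>F y in E. y \<in> B" "\<forall>x\<in>A. \<forall>y\<in>B. P (x \<otimes> y)"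
  then show "\<exists>Q R. eventually Q F \<and> eventually R E \<and>
      (\<forall>x y. Q x \<longrightarrow> R y \<longrightarrow> P (case (x, y) of (x, y) \<Rightarrow> x \<otimes> y))"
    by (intro exI[of _ "\<lambda>x. x \<in> A"] exI[of _ "\<lambda>x. x \<in> B"]) auto
qed

lemma eventually_filter_multI:
  "(\<forall>\<^sub>F x in F. x \<in> A) \<Longrightarrow> (\<forall>\<^sub>F y in E. y \<in> B) \<Longrightarrow> (\<And>x y. x \<in> A \<Longrightarrow> y \<in> B \<Longrightarrow> P (x \<otimes> y)) \<Longrightarrow>
   eventually P (F \<odot> E)"
  unfolding eventually_filter_mult by blast

lemma eventually_filter_multE:
  assumes "eventually P (F \<odot> E)"
  obtains A B where "\<forall>\<^sub>F x in F. x \<in> A" "\<forall>\<^sub>F y in E. y \<in> B" "\<And>x y. x \<in> A \<Longrightarrow> y \<in> B \<Longrightarrow> P (x \<otimes> y)"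
  using assms unfolding eventually_filter_mult by blast

lemma on_carrier_eventually: "on_carrier F \<longleftrightarrow> (\<forall>\<^sub>F x in F. x \<in> carrier G)"
  by (simp add: le_principal)

lemma filter_mult_mono: "F \<le> F' \<Longrightarrow> E \<le> E' \<Longrightarrow> F \<odot> E \<le> F' \<odot> E'"
  unfolding filter_mult_def by (intro filtermap_mono prod_filter_mono)

lemma filter_mult_carrier [simp]: "on_carrier F \<Longrightarrow> on_carrier E \<Longrightarrow> on_carrier (F \<odot> E)"
  unfolding on_carrier_eventually by (rule eventually_filter_multI) auto

lemma filter_inv_carrier [simp]: "on_carrier F \<Longrightarrow> on_carrier (filter_inv F)"
  unfolding on_carrier_eventually eventually_filtermap by (auto elim: eventually_mono)

lemma filter_mult_bot: "F \<odot> E = bot \<longleftrightarrow> F = bot \<or> E = bot"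
  unfolding filter_mult_def by (simp add: filtermap_bot_iff prod_filter_eq_bot)

lemma filter_inv_inv [simp]: "on_carrier F \<Longrightarrow> filter_inv (filter_inv F) = F"
  unfolding on_carrier_eventually filter_eq_iff eventually_filtermap
  by (auto elim: eventually_elim2)

lemma filter_mult_assoc [simp]:
  assumes "on_carrier F" "on_carrier E" "on_carrier H"
  shows "F \<odot> E \<odot> H = F \<odot> (E \<odot> H)"
proof -
  have c: "\<forall>\<^sub>F x in F. x \<in> carrier G" "\<forall>\<^sub>F x in E. x \<in> carrier G" "\<forall>\<^sub>F x in H. x \<in> carrier G"
    using assms by (simp_all add: on_carrier_eventually)
  show ?thesis
  proof (rule filter_eq_iff[THEN iffD2], intro allI iffI)
    fix P assume "eventually P (F \<odot> E \<odot> H)"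
    then obtain Y C where Y: "\<forall>\<^sub>F x in F \<odot> E. x \<in> Y" "\<forall>\<^sub>F x in H. x \<in> C"
      "\<And>x z. x \<in> Y \<Longrightarrow> z \<in> C \<Longrightarrow> P (x \<otimes> z)" by (rule eventually_filter_multE) blast
    obtain A B where A: "\<forall>\<^sub>F x in F. x \<in> A" "\<forall>\<^sub>F x in E. x \<in> B"
      "\<And>x z. x \<in> A \<Longrightarrow> z \<in> B \<Longrightarrow> x \<otimes> z \<in> Y" using Y(1) by (rule eventually_filter_multE) blast
    show "eventually P (F \<odot> (E \<odot> H))"
    proof (rule eventually_filter_multI)
      show "\<forall>\<^sub>F x in F. x \<in> A \<inter> carrier G" using A(1) c(1) by eventually_elim auto
      show "\<forall>\<^sub>F x in E \<odot> H. x \<in> {y \<otimes> z | y z. y \<in> B \<inter> carrier G \<and> z \<in> C \<inter> carrier G}"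
      proof (rule eventually_filter_multI)
        show "\<forall>\<^sub>F x in E. x \<in> B \<inter> carrier G" using A(2) c(2) by eventually_elim auto
        show "\<forall>\<^sub>F x in H. x \<in> C \<inter> carrier G" using Y(2) c(3) by eventually_elim auto
      qed blast
      fix x w assume "x \<in> A \<inter> carrier G" "w \<in> {y \<otimes> z | y z. y \<in> B \<inter> carrier G \<and> z \<in> C \<inter> carrier G}"
      then obtain y z where "x \<in> A" "y \<in> B" "z \<in> C" and [simp]: "x \<in> carrier G" "y \<in> carrier G" "z \<in> carrier G"
        "w = y \<otimes> z" by blast
      then have "P (x \<otimes> y \<otimes> z)" using A(3) Y(3) by blast
      then show "P (x \<otimes> w)" by (simp add: m_assoc)
    qed
  next
    fix P assume "eventually P (F \<odot> (E \<odot> H))"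
    then obtain A Y where Y: "\<forall>\<^sub>F x in F. x \<in> A" "\<forall>\<^sub>F x in E \<odot> H. x \<in> Y"
      "\<And>x z. x \<in> A \<Longrightarrow> z \<in> Y \<Longrightarrow> P (x \<otimes> z)" by (rule eventually_filter_multE) blast
    obtain B C where A: "\<forall>\<^sub>F x in E. x \<in> B" "\<forall>\<^sub>F x in H. x \<in> C"
      "\<And>x z. x \<in> B \<Longrightarrow> z \<in> C \<Longrightarrow> x \<otimes> z \<in> Y" using Y(2) by (rule eventually_filter_multE) blast
    show "eventually P (F \<odot> E \<odot> H)"
    proof (rule eventually_filter_multI)
      show "\<forall>\<^sub>F x in H. x \<in> C \<inter> carrier G" using A(2) c(3) by eventually_elim auto
      show "\<forall>\<^sub>F x in F \<odot> E. x \<in> {y \<otimes> z | y z. y \<in> A \<inter> carrier G \<and> z \<in> B \<inter> carrier G}"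
      proof (rule eventually_filter_multI)
        show "\<forall>\<^sub>F x in F. x \<in> A \<inter> carrier G" using Y(1) c(1) by eventually_elim auto
        show "\<forall>\<^sub>F x in E. x \<in> B \<inter> carrier G" using A(1) c(2) by eventually_elim auto
      qed blast
      fix z w assume "z \<in> C \<inter> carrier G" "w \<in> {y \<otimes> z | y z. y \<in> A \<inter> carrier G \<and> z \<in> B \<inter> carrier G}"
      then obtain x y where "x \<in> A" "y \<in> B" "z \<in> C" and [simp]: "x \<in> carrier G" "y \<in> carrier G" "z \<in> carrier G"
        "w = x \<otimes> y" by blast
      then have "P (x \<otimes> (y \<otimes> z))" using A(3) Y(3) by blast
      then show "P (w \<otimes> z)" by (simp add: m_assoc)
    qed
  qed
qed

lemma filter_inv_mult:
  assumes "on_carrier F" "on_carrier E"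
  shows "filter_inv (F \<odot> E) = filter_inv E \<odot> filter_inv F"
proof -
  have "filter_inv E \<odot> filter_inv F = filtermap (\<lambda>(x, y). inv y \<otimes> inv x) (F \<times>\<^sub>F E)"
    unfolding filter_mult_def prod_filtermap1 prod_filtermap2 filtermap_filtermap
    by (subst prod_filter_commute) (simp add: filtermap_filtermap o_def apfst_def apsnd_def split_beta)
  also have "\<dots> = filtermap (\<lambda>z. inv (case z of (x, y) \<Rightarrow> x \<otimes> y)) (F \<times>\<^sub>F E)"
  proof (rule filtermap_cong_eventually)
    have "\<forall>\<^sub>F z in F \<times>\<^sub>F E. fst z \<in> carrier G \<and> snd z \<in> carrier G"
      unfolding eventually_prod_filter
      by (intro exI[of _ "\<lambda>x. x \<in> carrier G"]) (use assms in \<open>auto simp: on_carrier_eventually\<close>)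
    then show "\<forall>\<^sub>F z in F \<times>\<^sub>F E. (case z of (x, y) \<Rightarrow> inv y \<otimes> inv x) = inv (case z of (x, y) \<Rightarrow> x \<otimes> y)"
      by eventually_elim (auto simp: inv_mult_group)
  qed
  also have "\<dots> = filter_inv (F \<odot> E)" by (simp add: filter_mult_def filtermap_filtermap)
  finally show ?thesis ..
qed

lemma filter_mult_principal:
  "principal {x} \<odot> principal {y} = principal {x \<otimes> y}"
  by (simp add: filter_mult_def principal_prod_principal filtermap_principal)

lemma principal_carrier [simp]: "x \<in> carrier G \<Longrightarrow> on_carrier (principal {x})"
  by simp

lemma filter_mult_one [simp]:
  assumes "on_carrier F"
  shows "principal {\<one>} \<odot> F = F" "F \<odot> principal {\<one>} = F"
proof -
  have "filtermap (\<lambda>x. \<one> \<otimes> x) F = filtermap (\<lambda>x. x) F"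
    by (rule filtermap_cong_eventually)
      (use assms in \<open>auto simp: on_carrier_eventually elim: eventually_mono\<close>)
  moreover have "filtermap (\<lambda>x. x \<otimes> \<one>) F = filtermap (\<lambda>x. x) F"
    by (rule filtermap_cong_eventually)
      (use assms in \<open>auto simp: on_carrier_eventually elim: eventually_mono\<close>)
  ultimately show "principal {\<one>} \<odot> F = F" "F \<odot> principal {\<one>} = F"
    by (simp_all add: filter_mult_def prod_filter_principal_singleton
        prod_filter_principal_singleton2 filtermap_filtermap filtermap_ident)
qed

text \<open>Inserting \<open>F\<^sup>-\<^sup>1 F\<close> or \<open>F F\<^sup>-\<^sup>1\<close> into a product makes the filter coarser. This turns the inequalities
  in the definition of a Cauchy filter into equations between products with \<open>\<N>\<close>.\<close>

lemma one_le_inv_mult: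
  assumes "F \<noteq> bot" "on_carrier F"
  shows "principal {\<one>} \<le> filter_inv F \<odot> F" "principal {\<one>} \<le> F \<odot> filter_inv F"
proof -
  have "P \<one>" if "eventually P (filter_inv F \<odot> F) \<or> eventually P (F \<odot> filter_inv F)" for P
    using that
  proof
    assume "eventually P (filter_inv F \<odot> F)"
    then obtain A B where AB: "\<forall>\<^sub>F x in F. inv x \<in> A" "\<forall>\<^sub>F x in F. x \<in> B"
      "\<And>x z. x \<in> A \<Longrightarrow> z \<in> B \<Longrightarrow> P (x \<otimes> z)"
      unfolding eventually_filter_mult eventually_filtermap by blast
    have "\<forall>\<^sub>F x in F. inv x \<in> A \<and> x \<in> B \<and> x \<in> carrier G"
      using AB assms(2) unfolding on_carrier_eventually by (auto intro: eventually_conj)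
    then obtain x where "inv x \<in> A" "x \<in> B" "x \<in> carrier G"
      using eventually_happens assms(1) by blast
    then show "P \<one>" using AB(3)[of "inv x" x] by simp
  next
    assume "eventually P (F \<odot> filter_inv F)"
    then obtain A B where AB: "\<forall>\<^sub>F x in F. x \<in> A" "\<forall>\<^sub>F x in F. inv x \<in> B"
      "\<And>x z. x \<in> A \<Longrightarrow> z \<in> B \<Longrightarrow> P (x \<otimes> z)"
      unfolding eventually_filter_mult eventually_filtermap by blast
    have "\<forall>\<^sub>F x in F. x \<in> A \<and> inv x \<in> B \<and> x \<in> carrier G"
      using AB assms(2) unfolding on_carrier_eventually by (auto intro: eventually_conj)
    then obtain x where "x \<in> A" "inv x \<in> B" "x \<in> carrier G"
      using eventually_happens assms(1) by blast
    then show "P \<one>" using AB(3)[of x "inv x"] by simp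
  qed
  then show "principal {\<one>} \<le> filter_inv F \<odot> F" "principal {\<one>} \<le> F \<odot> filter_inv F"
    unfolding le_filter_def eventually_principal by auto
qed

end

context topological_group
begin

abbreviation unit_filter :: "'a filter" ("\<N>") where
  "\<N> \<equiv> nhdsin T \<one>"

lemma eventually_unit_filter: "eventually P \<N> \<longleftrightarrow> (\<exists>U. unit_nbhd G T U \<and> (\<forall>u\<in>U. P u))"
  by (auto simp: eventually_nhdsin unit_nbhd_def topspace_eq_carrier)

lemma unit_filter_carrier [simp]: "on_carrier \<N>"
  unfolding on_carrier_eventually eventually_unit_filter using unit_nbhd_carrier unit_nbhd_top by blast

lemma one_le_unit_filter: "principal {\<one>} \<le> \<N>"
  unfolding le_filter_def eventually_principal eventually_unit_filter by (auto simp: unit_nbhd_def)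

lemma unit_filter_not_bot: "\<N> \<noteq> bot"
  unfolding trivial_limit_def eventually_unit_filter by (auto simp: unit_nbhd_def)

lemma unit_filter_mult [simp]: "\<N> \<odot> \<N> = \<N>"
proof (rule antisym)
  show "\<N> \<odot> \<N> \<le> \<N>"
    unfolding le_filter_def
  proof (intro allI impI)
    fix P assume "eventually P \<N>"
    then obtain U where U: "unit_nbhd G T U" "\<And>u. u \<in> U \<Longrightarrow> P u" unfolding eventually_unit_filter by blast
    obtain V where V: "unit_nbhd G T V" "\<And>x y. x\<in>V \<Longrightarrow> y\<in>V \<Longrightarrow> x \<otimes> y \<in> U"
      using unit_nbhd_mult[OF U(1)] by blast
    then have "\<forall>\<^sub>F x in \<N>. x \<in> V" unfolding eventually_unit_filter by blast
    then show "eventually P (\<N> \<odot> \<N>)"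
      by (rule eventually_filter_multI[of V _ V]) (use U V in \<open>auto simp: eventually_unit_filter\<close>)
  qed
  show "\<N> \<le> \<N> \<odot> \<N>"
    using filter_mult_mono[OF one_le_unit_filter order_refl[of \<N>]] by simp
qed

lemma unit_filter_inv [simp]: "filter_inv \<N> = \<N>"
proof -
  have le: "filter_inv \<N> \<le> \<N>"
    unfolding le_filter_def eventually_filtermap
  proof (intro allI impI)
    fix P assume "eventually P \<N>"
    then obtain U where U: "unit_nbhd G T U" "\<And>u. u \<in> U \<Longrightarrow> P u" unfolding eventually_unit_filter by blast
    then show "\<forall>\<^sub>F x in \<N>. P (inv x)"
      unfolding eventually_unit_filter using unit_nbhd_inv[OF U(1)] by blast
  qed
  from filtermap_mono[OF this, of "\<lambda>x. inv x"] have "\<N> \<le> filter_inv \<N>" by simp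
  with le show ?thesis by simp
qed

definition two_sided_Cauchy :: "'a filter \<Rightarrow> bool" where
  "two_sided_Cauchy F \<longleftrightarrow> F \<noteq> bot \<and> on_carrier F \<and> filter_inv F \<odot> F \<le> \<N> \<and> F \<odot> filter_inv F \<le> \<N>"

lemma Cauchy_on_carrier [simp]: "two_sided_Cauchy F \<Longrightarrow> on_carrier F"
  by (simp add: two_sided_Cauchy_def)

lemma Cauchy_inv: "two_sided_Cauchy F \<Longrightarrow> two_sided_Cauchy (filter_inv F)"
  by (simp add: two_sided_Cauchy_def filtermap_bot_iff)

text \<open>A Cauchy filter has a set \<open>D\<close> whose members differ from one \<open>a \<in> D\<close> by elements of a small
  neighbourhood, so conjugation by members of \<open>D\<close> is as continuous at the unit as conjugation by \<open>a\<close>.\<close>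

lemma Cauchy_conj:
  assumes "two_sided_Cauchy F"
  shows "filter_inv F \<odot> (\<N> \<odot> F) \<le> \<N>"
  unfolding le_filter_def
proof (intro allI impI)
  fix P assume "eventually P \<N>"
  then obtain U where U: "unit_nbhd G T U" "\<And>u. u \<in> U \<Longrightarrow> P u" unfolding eventually_unit_filter by blast
  obtain V where V: "unit_nbhd G T V" "\<And>x y z. x\<in>V \<Longrightarrow> y\<in>V \<Longrightarrow> z\<in>V \<Longrightarrow> x \<otimes> y \<otimes> z \<in> U"
    using unit_nbhd_symmetric_cube[OF U(1)] by metis
  have "\<forall>\<^sub>F x in \<N>. x \<in> V" using V(1) unfolding eventually_unit_filter by blast
  moreover have "filter_inv F \<odot> F \<le> \<N>" using assms by (simp add: two_sided_Cauchy_def)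
  ultimately have "\<forall>\<^sub>F x in filter_inv F \<odot> F. x \<in> V" by (metis filter_leD)
  then obtain A B where AB: "\<forall>\<^sub>F x in F. inv x \<in> A" "\<forall>\<^sub>F x in F. x \<in> B"
      "\<And>x z. x \<in> A \<Longrightarrow> z \<in> B \<Longrightarrow> x \<otimes> z \<in> V"
      unfolding eventually_filter_mult eventually_filtermap by blast
  define D where "D = {x \<in> carrier G. inv x \<in> A \<and> x \<in> B}"
  have D: "\<forall>\<^sub>F x in F. x \<in> D"
    using AB assms unfolding D_def two_sided_Cauchy_def on_carrier_eventually by (auto intro: eventually_conj)
  then obtain a where a: "a \<in> D" using eventually_happens assms unfolding two_sided_Cauchy_def by blast
  have ac: "a \<in> carrier G" using a by (simp add: D_def)
  obtain W where W: "unit_nbhd G T W" "\<And>w. w\<in>W \<Longrightarrow> inv a \<otimes> w \<otimes> a \<in> V"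
    using unit_nbhd_conj[OF V(1) ac] by blast
  have DW: "P (inv x \<otimes> (w \<otimes> y))" if "x \<in> D" "y \<in> D" "w \<in> W" for x y w
  proof -
    have "(inv x \<otimes> a) \<otimes> (inv a \<otimes> w \<otimes> a) \<otimes> (inv a \<otimes> y) \<in> U"
      using V W AB that a unfolding D_def by blast
    moreover have "x \<in> carrier G" "y \<in> carrier G" "w \<in> carrier G"
      using that unit_nbhd_carrier[OF W(1)] by (auto simp: D_def)
    ultimately show ?thesis using ac U by (simp add: group_normalize)
  qed
  show "eventually P (filter_inv F \<odot> (\<N> \<odot> F))"
  proof (rule eventually_filter_multI)
    show "\<forall>\<^sub>F x in filter_inv F. x \<in> (\<lambda>x. inv x) ` D"
      unfolding eventually_filtermap using D by eventually_elim auto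
    show "\<forall>\<^sub>F x in \<N> \<odot> F. x \<in> {w \<otimes> y | w y. w \<in> W \<and> y \<in> D}"
      by (rule eventually_filter_multI[of W _ D]) (use W D eventually_unit_filter in auto)
  qed (use DW in auto)
qed

text \<open>Multiply \<open>F\<^sup>-\<^sup>1 \<N> F \<le> \<N>\<close> by \<open>F\<close>. The equation says that the left and the right version of the
  coarsest equivalent filter agree.\<close>

lemma Cauchy_commute:
  assumes F: "two_sided_Cauchy F"
  shows "\<N> \<odot> F = F \<odot> \<N>"
proof (rule antisym)
  have ne: "F \<noteq> bot" using F by (simp add: two_sided_Cauchy_def)
  have "principal {\<one>} \<odot> (\<N> \<odot> F) \<le> (F \<odot> filter_inv F) \<odot> (\<N> \<odot> F)"
    by (intro filter_mult_mono one_le_inv_mult ne) (use F in auto)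
  also have "\<dots> = F \<odot> (filter_inv F \<odot> (\<N> \<odot> F))" using F by simp
  also have "\<dots> \<le> F \<odot> \<N>" by (intro filter_mult_mono Cauchy_conj F order_refl)
  finally show "\<N> \<odot> F \<le> F \<odot> \<N>" using F by simp
  have "(F \<odot> \<N>) \<odot> principal {\<one>} \<le> (F \<odot> \<N>) \<odot> (filter_inv F \<odot> F)"
    by (intro filter_mult_mono one_le_inv_mult ne) (use F in auto)
  also have "\<dots> = (F \<odot> (\<N> \<odot> filter_inv F)) \<odot> F" using F by simp
  also have "\<dots> \<le> \<N> \<odot> F"
    using filter_mult_mono[OF Cauchy_conj[OF Cauchy_inv[OF F]] order_refl[of F]] F by simp
  finally show "F \<odot> \<N> \<le> \<N> \<odot> F" using F by simp
qed

lemma Cauchy_mult: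
  assumes "two_sided_Cauchy F" "two_sided_Cauchy E"
  shows "two_sided_Cauchy (F \<odot> E)"
  unfolding two_sided_Cauchy_def
proof (intro conjI)
  show "F \<odot> E \<noteq> bot" using assms by (simp add: two_sided_Cauchy_def filter_mult_bot)
  have "filter_inv (F \<odot> E) \<odot> (F \<odot> E) = filter_inv E \<odot> ((filter_inv F \<odot> F) \<odot> E)"
    using assms by (simp add: filter_inv_mult)
  also have "\<dots> \<le> filter_inv E \<odot> (\<N> \<odot> E)"
    using assms(1) by (intro filter_mult_mono order_refl) (simp add: two_sided_Cauchy_def)
  also have "\<dots> \<le> \<N>" by (rule Cauchy_conj) fact
  finally show "filter_inv (F \<odot> E) \<odot> (F \<odot> E) \<le> \<N>" .
  have "(F \<odot> E) \<odot> filter_inv (F \<odot> E) = F \<odot> ((E \<odot> filter_inv E) \<odot> filter_inv F)"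
    using assms by (simp add: filter_inv_mult)
  also have "\<dots> \<le> F \<odot> (\<N> \<odot> filter_inv F)"
    using assms(2) by (intro filter_mult_mono order_refl) (simp add: two_sided_Cauchy_def)
  also have "\<dots> \<le> \<N>" using Cauchy_conj[OF Cauchy_inv[OF assms(1)]] assms by simp
  finally show "(F \<odot> E) \<odot> filter_inv (F \<odot> E) \<le> \<N>" .
qed (use assms in auto)

lemma Cauchy_unit_filter: "two_sided_Cauchy \<N>"
  by (simp add: two_sided_Cauchy_def unit_filter_not_bot)

lemma filter_inv_principal: "filter_inv (principal {x}) = principal {inv x}"
  by (simp add: filtermap_principal)

lemma Cauchy_principal: "x \<in> carrier G \<Longrightarrow> two_sided_Cauchy (principal {x})"
  using one_le_unit_filter
  by (simp add: two_sided_Cauchy_def filter_inv_principal filter_mult_principal principal_eq_bot_iff)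

definition completion :: "'a filter monoid" where
  "completion = \<lparr>carrier = {F. two_sided_Cauchy F \<and> F \<odot> \<N> = F}, mult = (\<odot>), one = \<N>\<rparr>"

lemma completion_simps [simp]:
  "F \<in> carrier completion \<longleftrightarrow> two_sided_Cauchy F \<and> F \<odot> \<N> = F"
  "F \<otimes>\<^bsub>completion\<^esub> E = F \<odot> E" "\<one>\<^bsub>completion\<^esub> = \<N>"
  by (simp_all add: completion_def)

lemma completion_inv_closed:
  assumes "two_sided_Cauchy F" "F \<odot> \<N> = F"
  shows "filter_inv F \<odot> \<N> = filter_inv F"
proof -
  have "filter_inv F \<odot> \<N> = filter_inv (\<N> \<odot> F)" using assms(1) by (simp add: filter_inv_mult)
  also have "\<dots> = filter_inv F" using Cauchy_commute assms by simp
  finally show ?thesis .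
qed

lemma completion_inv_mult:
  assumes "two_sided_Cauchy F" "F \<odot> \<N> = F"
  shows "filter_inv F \<odot> F = \<N>"
proof (rule antisym)
  have "principal {\<one>} \<odot> \<N> \<le> (filter_inv F \<odot> F) \<odot> \<N>"
    by (intro filter_mult_mono one_le_inv_mult order_refl) (use assms in \<open>auto simp: two_sided_Cauchy_def\<close>)
  then show "\<N> \<le> filter_inv F \<odot> F" using assms by simp
qed (use assms in \<open>simp add: two_sided_Cauchy_def\<close>)

lemma group_completion: "group completion"
proof (rule groupI)
  fix F E assume "F \<in> carrier completion" "E \<in> carrier completion"
  then show "F \<otimes>\<^bsub>completion\<^esub> E \<in> carrier completion" by (simp add: Cauchy_mult)
next
  fix F assume "F \<in> carrier completion"
  then show "\<exists>E\<in>carrier completion. E \<otimes>\<^bsub>completion\<^esub> F = \<one>\<^bsub>completion\<^esub>"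
    by (intro bexI[of _ "filter_inv F"])
      (simp_all add: completion_inv_mult completion_inv_closed Cauchy_inv)
qed (simp_all add: Cauchy_unit_filter Cauchy_commute)

lemma completion_inv:
  assumes "F \<in> carrier completion"
  shows "inv\<^bsub>completion\<^esub> F = filter_inv F"
  by (rule group.inv_equality[OF group_completion])
    (use assms in \<open>simp_all add: completion_inv_mult completion_inv_closed Cauchy_inv\<close>)

definition completion_nbhd :: "'a set \<Rightarrow> 'a filter set" where
  "completion_nbhd U = {F \<in> carrier completion. \<forall>\<^sub>F x in F. x \<in> U}"

definition completion_base :: "'a filter set set" where
  "completion_base = completion_nbhd ` Collect (unit_nbhd G T)"

lemma group_base_completion: "group_base completion completion_base"
proof -
  interpret C: group completion by (rule group_completion)
  show ?thesis
  proof
    show "completion_base \<noteq> {}" using unit_nbhd_top by (auto simp: completion_base_def)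
    fix \<U> assume "\<U> \<in> completion_base"
    then obtain U where U: "unit_nbhd G T U" and \<U>: "\<U> = completion_nbhd U"
      by (auto simp: completion_base_def)
    show "\<U> \<subseteq> carrier completion" by (auto simp: \<U> completion_nbhd_def)
    show "\<one>\<^bsub>completion\<^esub> \<in> \<U>"
      using U by (auto simp: \<U> completion_nbhd_def Cauchy_unit_filter eventually_unit_filter)
    show "\<exists>\<W>\<in>completion_base. \<W> \<subseteq> \<U> \<inter> \<V>" if \<V>_base: "\<V> \<in> completion_base" for \<V>
    proof -
      obtain V where V: "unit_nbhd G T V" and \<V>: "\<V> = completion_nbhd V"
        using \<V>_base by (auto simp: completion_base_def)
      have "completion_nbhd (U \<inter> V) \<subseteq> \<U> \<inter> \<V>"
        by (auto simp: completion_nbhd_def \<U> \<V> elim: eventually_mono)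
      then show ?thesis using unit_nbhd_Int[OF U V] by (auto simp: completion_base_def)
    qed
    show "\<exists>\<V>\<in>completion_base. \<forall>F\<in>\<V>. \<forall>E\<in>\<V>. F \<otimes>\<^bsub>completion\<^esub> E \<in> \<U>"
    proof -
      obtain V where V: "unit_nbhd G T V" "\<And>x y. x\<in>V \<Longrightarrow> y\<in>V \<Longrightarrow> x \<otimes> y \<in> U"
        using unit_nbhd_mult[OF U] by blast
      have "F \<otimes>\<^bsub>completion\<^esub> E \<in> \<U>" if "F \<in> completion_nbhd V" "E \<in> completion_nbhd V" for F E
        using that V by (auto simp: completion_nbhd_def \<U> Cauchy_mult intro: eventually_filter_multI)
      then show ?thesis using V(1) by (auto simp: completion_base_def)
    qed
    show "\<exists>\<V>\<in>completion_base. \<forall>F\<in>\<V>. inv\<^bsub>completion\<^esub> F \<in> \<U>"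
    proof -
      let ?V = "{x \<in> carrier G. inv x \<in> U}"
      have "inv\<^bsub>completion\<^esub> F \<in> \<U>" if F: "F \<in> completion_nbhd ?V" for F
      proof -
        have "F \<in> carrier completion" "\<forall>\<^sub>F x in F. inv x \<in> U"
          using F by (auto simp: completion_nbhd_def elim: eventually_mono)
        then show ?thesis
          using completion_inv C.inv_closed[of F] by (simp add: completion_nbhd_def \<U> eventually_filtermap)
      qed
      then show ?thesis using unit_nbhd_inv[OF U] unfolding completion_base_def by blast
    qed
    show "\<exists>\<V>\<in>completion_base. \<forall>F\<in>\<V>. inv\<^bsub>completion\<^esub> E \<otimes>\<^bsub>completion\<^esub> F \<otimes>\<^bsub>completion\<^esub> E \<in> \<U>"
      if E: "E \<in> carrier completion" for E
    proof -
      have "\<forall>\<^sub>F x in \<N>. x \<in> U" using U by (auto simp: eventually_unit_filter)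
      moreover have "filter_inv E \<odot> (\<N> \<odot> E) \<le> \<N>" using E by (intro Cauchy_conj) simp
      ultimately have "\<forall>\<^sub>F x in filter_inv E \<odot> (\<N> \<odot> E). x \<in> U" by (metis filter_leD)
      then obtain A B where AB: "\<forall>\<^sub>F x in filter_inv E. x \<in> A" "\<forall>\<^sub>F x in \<N> \<odot> E. x \<in> B"
        "\<And>x z. x \<in> A \<Longrightarrow> z \<in> B \<Longrightarrow> x \<otimes> z \<in> U" by (rule eventually_filter_multE) blast
      obtain V D where VD: "\<forall>\<^sub>F x in \<N>. x \<in> V" "\<forall>\<^sub>F x in E. x \<in> D"
        "\<And>x z. x \<in> V \<Longrightarrow> z \<in> D \<Longrightarrow> x \<otimes> z \<in> B" using AB(2) by (rule eventually_filter_multE) blast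
      obtain W where W: "unit_nbhd G T W" "W \<subseteq> V" using VD(1) by (auto simp: eventually_unit_filter)
      have "inv\<^bsub>completion\<^esub> E \<otimes>\<^bsub>completion\<^esub> F \<otimes>\<^bsub>completion\<^esub> E \<in> \<U>" if F: "F \<in> completion_nbhd W" for F
      proof -
        have Fc: "F \<in> carrier completion" and "\<forall>\<^sub>F x in F. x \<in> V"
          using F W(2) by (auto simp: completion_nbhd_def elim: eventually_mono)
        then have "\<forall>\<^sub>F x in F \<odot> E. x \<in> B" using VD by (auto intro: eventually_filter_multI)
        then have "\<forall>\<^sub>F x in filter_inv E \<odot> (F \<odot> E). x \<in> U" using AB by (auto intro: eventually_filter_multI)
        moreover have "inv\<^bsub>completion\<^esub> E \<otimes>\<^bsub>completion\<^esub> F \<otimes>\<^bsub>completion\<^esub> E \<in> carrier completion"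
          using E Fc by (intro C.m_closed C.inv_closed)
        moreover have "inv\<^bsub>completion\<^esub> E \<otimes>\<^bsub>completion\<^esub> F \<otimes>\<^bsub>completion\<^esub> E = filter_inv E \<odot> (F \<odot> E)"
          using E Fc by (simp add: completion_inv)
        ultimately show ?thesis by (simp only: completion_nbhd_def \<U> mem_Collect_eq)
      qed
      then show ?thesis using W(1) unfolding completion_base_def by blast
    qed
  qed
qed

text \<open>The completion is Hausdorff because its elements are as coarse as possible: \<open>F \<le> \<N>\<close> implies
  \<open>\<N> = F F\<^sup>-\<^sup>1 \<le> F \<N> = F\<close>.\<close>

lemma Inter_completion_base: "\<Inter>completion_base = {\<one>\<^bsub>completion\<^esub>}"
proof (intro equalityI subsetI)
  interpret B: group_base completion completion_base by (rule group_base_completion)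
  show "F \<in> \<Inter>completion_base" if "F \<in> {\<one>\<^bsub>completion\<^esub>}" for F using that B.base_one by auto
  fix F assume F: "F \<in> \<Inter>completion_base"
  then have Fc: "two_sided_Cauchy F" "F \<odot> \<N> = F"
    using unit_nbhd_top by (auto simp: completion_base_def completion_nbhd_def)
  have "\<forall>\<^sub>F x in F. x \<in> U" if "unit_nbhd G T U" for U
    using F that by (auto simp: completion_base_def completion_nbhd_def)
  then have le: "F \<le> \<N>"
    unfolding le_filter_def eventually_unit_filter by (meson eventually_mono)
  then have "filter_inv F \<le> \<N>" using filtermap_mono[OF le, of "\<lambda>x. inv x"] by simp
  then have "F \<odot> filter_inv F \<le> F \<odot> \<N>" by (rule filter_mult_mono[OF order_refl])
  then have "filter_inv (filter_inv F) \<odot> filter_inv F \<le> F \<odot> \<N>" using Fc by simp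
  moreover have "filter_inv (filter_inv F) \<odot> filter_inv F = \<N>"
    using Fc by (intro completion_inv_mult Cauchy_inv completion_inv_closed)
  ultimately show "F \<in> {\<one>\<^bsub>completion\<^esub>}" using le Fc by simp
qed

abbreviation completion_topology :: "'a filter topology" where
  "completion_topology \<equiv> group_topology completion completion_base"

lemma topological_group_completion: "topological_group completion completion_topology"
  using group_base.group_topology_group[OF group_base_completion Inter_completion_base] .

definition completion_embed :: "'a \<Rightarrow> 'a filter" where
  "completion_embed x = principal {x} \<odot> \<N>"

lemma completion_embed_carrier: "x \<in> carrier G \<Longrightarrow> completion_embed x \<in> carrier completion"
  by (simp add: completion_embed_def Cauchy_mult Cauchy_principal Cauchy_unit_filter del: le_principal)

lemma completion_embed_hom: "completion_embed \<in> hom G completion"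
proof (rule homI)
  fix x y assume xy: "x \<in> carrier G" "y \<in> carrier G"
  have "(principal {x} \<odot> \<N>) \<odot> (principal {y} \<odot> \<N>) = principal {x} \<odot> ((\<N> \<odot> principal {y}) \<odot> \<N>)"
    using xy by simp
  also have "\<dots> = (principal {x} \<odot> principal {y}) \<odot> \<N>"
    using xy by (simp add: Cauchy_commute Cauchy_principal)
  finally show "completion_embed (x \<otimes> y) = completion_embed x \<otimes>\<^bsub>completion\<^esub> completion_embed y"
    by (simp add: completion_embed_def filter_mult_principal)
qed (rule completion_embed_carrier)

lemma completion_embed_inj: "inj_on completion_embed (carrier G)"
proof (rule inj_onI, rule ccontr)
  fix x y assume xy: "x \<in> carrier G" "y \<in> carrier G" "completion_embed x = completion_embed y" "x \<noteq> y"
  define g where "g = inv x \<otimes> y"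
  have g: "g \<in> carrier G" "g \<noteq> \<one>" using xy unfolding g_def
    by (auto dest: inv_equality) (metis inv_equality inv_inv inv_closed)
  have "principal {inv x} \<odot> completion_embed x = principal {inv x} \<odot> completion_embed y" using xy by simp
  then have "(principal {inv x} \<odot> principal {x}) \<odot> \<N> = (principal {inv x} \<odot> principal {y}) \<odot> \<N>"
    using xy by (simp add: completion_embed_def)
  then have "\<N> = principal {g} \<odot> \<N>" using xy by (simp add: filter_mult_principal g_def del: filter_mult_assoc)
  moreover have "principal {g} \<odot> principal {\<one>} \<le> principal {g} \<odot> \<N>"
    by (intro filter_mult_mono order_refl one_le_unit_filter)
  ultimately have "principal {g} \<le> \<N>" using g by (simp del: le_principal)
  then have "g \<in> U" if "unit_nbhd G T U" for U
    using that filter_leD[of "principal {g}" \<N> "\<lambda>x. x \<in> U"]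
    by (auto simp: eventually_unit_filter eventually_principal)
  then show False using unit_nbhd_separates[OF g] by blast
qed

lemma completion_embed_nbhd:
  assumes "unit_nbhd G T U" "u \<in> U"
  shows "completion_embed u \<in> completion_nbhd U"
proof -
  have "u \<in> carrier G" using unit_nbhd_carrier assms by blast
  moreover obtain V where V: "unit_nbhd G T V" "\<And>v. v \<in> V \<Longrightarrow> u \<otimes> v \<in> U"
    using open_contains_translate[of U u] assms by (auto simp: unit_nbhd_def)
  have "\<forall>\<^sub>F x in completion_embed u. x \<in> U"
    unfolding completion_embed_def
    by (rule eventually_filter_multI[of "{u}" _ V])
      (use V in \<open>auto simp: eventually_principal eventually_unit_filter\<close>)
  ultimately show ?thesis using completion_embed_carrier by (simp add: completion_nbhd_def)
qed

lemma completion_embed_le_nhdsin: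
  assumes "x \<in> carrier G"
  shows "completion_embed x \<le> nhdsin T x"
  unfolding le_filter_def
proof (intro allI impI)
  fix P assume "eventually P (nhdsin T x)"
  then obtain A where A: "openin T A" "x \<in> A" "\<And>y. y \<in> A \<Longrightarrow> P y"
    using assms by (auto simp: eventually_nhdsin topspace_eq_carrier)
  obtain V where V: "unit_nbhd G T V" "\<And>v. v \<in> V \<Longrightarrow> x \<otimes> v \<in> A"
    using open_contains_translate[OF A(1,2)] by blast
  show "eventually P (completion_embed x)"
    unfolding completion_embed_def
    by (rule eventually_filter_multI[of "{x}" _ V])
      (use V A in \<open>auto simp: eventually_principal eventually_unit_filter\<close>)
qed

lemma Cauchy_if_two_sided:
  assumes "F \<noteq> bot" "F \<times>\<^sub>F F \<le> two_sided_uniformity G T"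
  shows "two_sided_Cauchy F"
proof -
  have small: "\<exists>A. (\<forall>\<^sub>F x in F. x \<in> A) \<and> small_set G U A" if "unit_nbhd G T U" for U
    using assms(2) that unfolding Cauchy_iff_small_sets by blast
  have c: "on_carrier F"
    using small[OF unit_nbhd_top] unfolding on_carrier_eventually small_set_def
    by (auto elim: eventually_mono)
  have "eventually P (filter_inv F \<odot> F) \<and> eventually P (F \<odot> filter_inv F)" if P: "eventually P \<N>" for P
  proof -
    obtain U where U: "unit_nbhd G T U" "\<And>u. u \<in> U \<Longrightarrow> P u"
      using P unfolding eventually_unit_filter by blast
    obtain A where A: "\<forall>\<^sub>F x in F. x \<in> A" "small_set G U A" using small[OF U(1)] by blast
    have I: "\<forall>\<^sub>F x in filter_inv F. x \<in> (\<lambda>x. inv x) ` A"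
      unfolding eventually_filtermap using A(1) by eventually_elim auto
    have "eventually P (filter_inv F \<odot> F)"
      by (rule eventually_filter_multI[OF I A(1)]) (use A U in \<open>auto simp: small_set_def\<close>)
    moreover have "eventually P (F \<odot> filter_inv F)"
      by (rule eventually_filter_multI[OF A(1) I]) (use A U in \<open>auto simp: small_set_def\<close>)
    ultimately show ?thesis ..
  qed
  then show ?thesis using assms(1) c unfolding two_sided_Cauchy_def le_filter_def by blast
qed

text \<open>For a Cauchy filter \<open>F\<close>, the element \<open>F \<N>\<close> of the completion is a limit of elements of the group:
  \<open>(F \<N>)\<^sup>-\<^sup>1 a \<N> = F\<^sup>-\<^sup>1 a \<N>\<close> is close to \<open>\<N>\<close> as soon as \<open>a\<close> lies in a small member of \<open>F\<close>. If the image
  is closed, \<open>F \<N>\<close> is the neighbourhood filter of a point, to which \<open>F\<close> then converges.\<close>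

lemma complete_if_closed_in_completion:
  assumes closed: "closedin completion_topology (completion_embed ` carrier G)"
  shows "complete_group G T"
  unfolding complete_group_def
proof (intro allI impI, elim conjE)
  interpret B: group_base completion completion_base by (rule group_base_completion)
  fix F assume F: "F \<noteq> bot" "F \<times>\<^sub>F F \<le> two_sided_uniformity G T"
  have CF: "two_sided_Cauchy F" using F by (rule Cauchy_if_two_sided)
  define H where "H = F \<odot> \<N>"
  have H: "H \<in> carrier completion" using CF by (simp add: H_def Cauchy_mult Cauchy_unit_filter)
  have "H \<in> completion_topology closure_of (completion_embed ` carrier G)"
    unfolding in_closure_of B.topspace_group_topology
  proof (intro conjI H allI impI, elim conjE)
    fix Q assume Q: "H \<in> Q" "openin completion_topology Q"
    from Q(2)[unfolded B.openin_group_topology] Q(1) obtain \<U> where "\<U> \<in> completion_base"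
      "\<And>K. K \<in> carrier completion \<Longrightarrow> inv\<^bsub>completion\<^esub> H \<otimes>\<^bsub>completion\<^esub> K \<in> \<U> \<Longrightarrow> K \<in> Q"
      by blast
    then obtain U where U: "unit_nbhd G T U"
      "\<And>K. K \<in> carrier completion \<Longrightarrow> inv\<^bsub>completion\<^esub> H \<otimes>\<^bsub>completion\<^esub> K \<in> completion_nbhd U \<Longrightarrow> K \<in> Q"
      unfolding completion_base_def by blast
    obtain V where V: "unit_nbhd G T V" "\<And>x y. x\<in>V \<Longrightarrow> y\<in>V \<Longrightarrow> x \<otimes> y \<in> U"
      using unit_nbhd_mult[OF U(1)] by blast
    obtain A where A: "\<forall>\<^sub>F x in F. x \<in> A" "small_set G V A"
      using F(2) V(1) unfolding Cauchy_iff_small_sets by blast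
    obtain a where a: "a \<in> A" using A(1) F(1) eventually_happens by blast
    have ac: "a \<in> carrier G" using a A(2) by (auto simp: small_set_def)
    have I: "\<forall>\<^sub>F x in filter_inv F. x \<in> (\<lambda>x. inv x) ` A"
      unfolding eventually_filtermap using A(1) by eventually_elim auto
    have "filter_inv H \<odot> completion_embed a = (\<N> \<odot> filter_inv F) \<odot> (principal {a} \<odot> \<N>)"
      using CF by (simp add: H_def filter_inv_mult completion_embed_def)
    also have "\<N> \<odot> filter_inv F = filter_inv F \<odot> \<N>" using CF by (intro Cauchy_commute Cauchy_inv)
    also have "(filter_inv F \<odot> \<N>) \<odot> (principal {a} \<odot> \<N>) = filter_inv F \<odot> ((\<N> \<odot> principal {a}) \<odot> \<N>)"
      using CF ac by simp
    also have "\<dots> = (filter_inv F \<odot> principal {a}) \<odot> \<N>"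
      using CF ac by (simp add: Cauchy_commute Cauchy_principal)
    finally have eq: "filter_inv H \<odot> completion_embed a = (filter_inv F \<odot> principal {a}) \<odot> \<N>" .
    have "\<forall>\<^sub>F x in filter_inv F \<odot> principal {a}. x \<in> V"
      by (rule eventually_filter_multI[OF I, where B = "{a}"])
        (use A a in \<open>auto simp: small_set_def eventually_principal\<close>)
    then have "\<forall>\<^sub>F x in (filter_inv F \<odot> principal {a}) \<odot> \<N>. x \<in> U"
      by (rule eventually_filter_multI[of V _ V]) (use V in \<open>auto simp: eventually_unit_filter\<close>)
    then have "inv\<^bsub>completion\<^esub> H \<otimes>\<^bsub>completion\<^esub> completion_embed a \<in> completion_nbhd U"
      using B.m_closed[OF B.inv_closed[OF H] completion_embed_carrier[OF ac]] eq
      by (simp add: completion_nbhd_def completion_inv[OF H] del: filter_mult_assoc)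
    then show "\<exists>y. y \<in> completion_embed ` carrier G \<and> y \<in> Q"
      using U(2) completion_embed_carrier[OF ac] ac by blast
  qed
  then obtain x where x: "x \<in> carrier G" "H = completion_embed x"
    using closed by (auto simp: closure_of_closedin)
  have "F \<odot> principal {\<one>} \<le> H" unfolding H_def by (intro filter_mult_mono order_refl one_le_unit_filter)
  then have "F \<le> nhdsin T x" using CF x completion_embed_le_nhdsin[OF x(1)] by (simp del: le_principal)
  then show "\<exists>x\<in>carrier G. F \<le> nhdsin T x" using x(1) by blast
qed

end

section \<open>Coarser topologies with a countable base at the unit\<close>

lemma (in group_base) countable_unit_base_group_topology:
  assumes "countable \<B>"
  shows "\<exists>u. countable_unit_base G (group_topology G \<B>) u"
proof -
  obtain I where I: "\<And>U. U \<in> \<B> \<Longrightarrow> unit_nbhd G (group_topology G \<B>) (I U) \<and> I U \<subseteq> U"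
    using group_topology_base(1) by metis
  have "\<exists>n. I (from_nat_into \<B> n) \<subseteq> V" if V: "unit_nbhd G (group_topology G \<B>) V" for V
  proof -
    obtain U where U: "U \<in> \<B>" "U \<subseteq> V" using group_topology_base(2)[OF V] by blast
    obtain n where "from_nat_into \<B> n = U" using from_nat_into_surj[OF assms U(1)] by blast
    then show ?thesis using I U by blast
  qed
  moreover have "unit_nbhd G (group_topology G \<B>) (I (from_nat_into \<B> n))" for n
    using I from_nat_into[OF base_nonempty] by blast
  ultimately show ?thesis unfolding countable_unit_base_def by (intro exI[of _ "\<lambda>n. I (from_nat_into \<B> n)"]) blast
qed

context topological_group
begin

text \<open>With \<open>g = c v\<close>, \<open>v \<in> V\<close>, conjugation by \<open>g\<close> is conjugation by \<open>c\<close> followed by conjugation by an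
  element of the small set \<open>V\<close>. So the countably many neighbourhoods \<open>W c\<close> control all conjugations.\<close>

lemma omega_narrow_refine:
  assumes "omega_narrow G T" "unit_nbhd G T U"
  shows "\<exists>\<R>. countable \<R> \<and> (\<forall>V\<in>\<R>. unit_nbhd G T V) \<and> (\<exists>V\<in>\<R>. \<forall>x\<in>V. \<forall>y\<in>V. x \<otimes> y \<in> U) \<and>
    (\<exists>V\<in>\<R>. \<forall>x\<in>V. inv x \<in> U) \<and> (\<forall>g\<in>carrier G. \<exists>V\<in>\<R>. \<forall>x\<in>V. inv g \<otimes> x \<otimes> g \<in> U)"
proof -
  obtain V where V: "unit_nbhd G T V" "V \<subseteq> U" "\<And>v. v\<in>V \<Longrightarrow> inv v \<in> V"
    "\<And>v w. v\<in>V \<Longrightarrow> w\<in>V \<Longrightarrow> v \<otimes> w \<in> U" "\<And>x y z. x\<in>V \<Longrightarrow> y\<in>V \<Longrightarrow> z\<in>V \<Longrightarrow> x \<otimes> y \<otimes> z \<in> U"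
    using unit_nbhd_symmetric_cube[OF assms(2)] by metis
  obtain C where C: "C \<subseteq> carrier G" "countable C" "carrier G = C <#> V"
    using assms(1) unit_nbhd_imp_neighbourhood[OF V(1)] unfolding omega_narrow_def by blast
  have "\<exists>W. unit_nbhd G T W \<and> (\<forall>w\<in>W. inv c \<otimes> w \<otimes> c \<in> V)" if "c \<in> C" for c
    using unit_nbhd_conj[OF V(1)] that C(1) by blast
  then obtain W where W: "\<And>c. c \<in> C \<Longrightarrow> unit_nbhd G T (W c)"
    "\<And>c w. c \<in> C \<Longrightarrow> w \<in> W c \<Longrightarrow> inv c \<otimes> w \<otimes> c \<in> V"
    by metis
  have conj: "\<exists>V'\<in>insert V (W ` C). \<forall>x\<in>V'. inv g \<otimes> x \<otimes> g \<in> U" if g: "g \<in> carrier G" for g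
  proof -
    obtain c v where cv: "c \<in> C" "v \<in> V" "g = c \<otimes> v" using g C(3) by (auto simp: set_mult_def)
    have "inv g \<otimes> x \<otimes> g \<in> U" if x: "x \<in> W c" for x
    proof -
      have "inv v \<otimes> (inv c \<otimes> x \<otimes> c) \<otimes> v \<in> U" using V W cv x by blast
      moreover have "c \<in> carrier G" "v \<in> carrier G" "x \<in> carrier G"
        using cv x C(1) unit_nbhd_carrier[OF V(1)] unit_nbhd_carrier[OF W(1)[OF cv(1)]] by auto
      ultimately show ?thesis using cv(3) by (simp add: group_normalize)
    qed
    then show ?thesis using cv(1) by blast
  qed
  show ?thesis
  proof (intro exI[of _ "insert V (W ` C)"] conjI)
    show "countable (insert V (W ` C))" using C(2) by simp
    show "\<forall>V'\<in>insert V (W ` C). unit_nbhd G T V'" using V(1) W(1) by blast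
    show "\<exists>V'\<in>insert V (W ` C). \<forall>x\<in>V'. \<forall>y\<in>V'. x \<otimes> y \<in> U"
      by (rule bexI[of _ V]) (use V(4) in auto)
    show "\<exists>V'\<in>insert V (W ` C). \<forall>x\<in>V'. inv x \<in> U"
      by (rule bexI[of _ V]) (use V(2,3) in auto)
    show "\<forall>g\<in>carrier G. \<exists>V'\<in>insert V (W ` C). \<forall>x\<in>V'. inv g \<otimes> x \<otimes> g \<in> U"
      using conj by (rule ballI)
  qed
qed

text \<open>Close the family under intersections and under the countable refinements of its members.\<close>

lemma omega_narrow_countable_group_base:
  assumes narrow: "omega_narrow G T" and "countable \<B>\<^sub>0" and nbhd: "\<forall>U\<in>\<B>\<^sub>0. unit_nbhd G T U"
  shows "\<exists>\<B>. \<B>\<^sub>0 \<subseteq> \<B> \<and> countable \<B> \<and> (\<forall>U\<in>\<B>. unit_nbhd G T U) \<and> group_base G \<B>"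
proof -
  define refines where "refines \<R> U \<longleftrightarrow> countable \<R> \<and> (\<forall>V\<in>\<R>. unit_nbhd G T V) \<and>
    (\<exists>V\<in>\<R>. \<forall>x\<in>V. \<forall>y\<in>V. x \<otimes> y \<in> U) \<and> (\<exists>V\<in>\<R>. \<forall>x\<in>V. inv x \<in> U) \<and>
    (\<forall>g\<in>carrier G. \<exists>V\<in>\<R>. \<forall>x\<in>V. inv g \<otimes> x \<otimes> g \<in> U)" for \<R> U
  have "\<exists>\<R>. refines \<R> U" if "unit_nbhd G T U" for U
    unfolding refines_def by (rule omega_narrow_refine[OF narrow that])
  then obtain R where R: "\<And>U. unit_nbhd G T U \<Longrightarrow> refines (R U) U"
    by metis
  have R1: "countable (R U)" "\<And>V. V \<in> R U \<Longrightarrow> unit_nbhd G T V" if "unit_nbhd G T U" for U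
    using R[OF that] by (simp_all add: refines_def)
  define step where "step \<B> = \<B> \<union> (\<Union>U\<in>\<B>. R U) \<union> (\<lambda>(U, V). U \<inter> V) ` (\<B> \<times> \<B>)" for \<B>
  \<comment> \<open>The carrier is added because \<open>\<B>\<^sub>0\<close> may be empty.\<close>
  define B where "B n = (step ^^ n) (insert (carrier G) \<B>\<^sub>0)" for n
  have B0: "B 0 = insert (carrier G) \<B>\<^sub>0" and BS: "B (Suc n) = step (B n)" for n
    by (simp_all add: B_def)
  have B: "countable (B n) \<and> (\<forall>U\<in>B n. unit_nbhd G T U)" for n
  proof (induction n)
    case 0
    then show ?case using assms unit_nbhd_top by (simp add: B0)
  next
    case (Suc n)
    then have "countable (B (Suc n))"
      unfolding BS step_def using R1(1) by (intro countable_Un countable_UN countable_image countable_SIGMA) auto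
    moreover have "\<forall>U\<in>B (Suc n). unit_nbhd G T U"
      unfolding BS step_def using R1(2) Suc by (auto intro: unit_nbhd_Int)
    ultimately show ?case ..
  qed
  have mono: "B m \<subseteq> B n" if "m \<le> n" for m n
    by (rule lift_Suc_mono_le[OF _ that]) (auto simp: BS step_def)
  define \<B> where "\<B> = (\<Union>n. B n)"
  have \<B>: "countable \<B>" "\<And>U. U \<in> \<B> \<Longrightarrow> unit_nbhd G T U" using B by (auto simp: \<B>_def)
  have RB: "R U \<subseteq> \<B>" if U: "U \<in> \<B>" for U
  proof -
    obtain n where "U \<in> B n" using U unfolding \<B>_def by blast
    then have "R U \<subseteq> B (Suc n)" unfolding BS step_def by blast
    then show ?thesis unfolding \<B>_def by blast
  qed
  have IntB: "U \<inter> V \<in> \<B>" if UV: "U \<in> \<B>" "V \<in> \<B>" for U V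
  proof -
    obtain m n where "U \<in> B m" "V \<in> B n" using UV unfolding \<B>_def by blast
    then have "U \<in> B (max m n)" "V \<in> B (max m n)" using mono[of m "max m n"] mono[of n "max m n"] by auto
    then have "U \<inter> V \<in> B (Suc (max m n))" unfolding BS step_def by blast
    then show ?thesis unfolding \<B>_def by blast
  qed
  have "\<B>\<^sub>0 \<subseteq> \<B>" and ne: "carrier G \<in> \<B>" using B0 unfolding \<B>_def by blast+
  moreover have "group_base G \<B>"
  proof
    show "\<B> \<noteq> {}" using ne by blast
    fix U assume U: "U \<in> \<B>"
    show "U \<subseteq> carrier G" "\<one> \<in> U"
      using unit_nbhd_carrier[OF \<B>(2)[OF U]] \<B>(2)[OF U] by (auto simp: unit_nbhd_def)
    show "\<exists>W\<in>\<B>. W \<subseteq> U \<inter> V" if "V \<in> \<B>" for V using IntB[OF U that] by blast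
    have RU: "(\<exists>V\<in>R U. \<forall>x\<in>V. \<forall>y\<in>V. x \<otimes> y \<in> U)" "(\<exists>V\<in>R U. \<forall>x\<in>V. inv x \<in> U)"
      "\<And>g. g \<in> carrier G \<Longrightarrow> \<exists>V\<in>R U. \<forall>x\<in>V. inv g \<otimes> x \<otimes> g \<in> U"
      using R[OF \<B>(2)[OF U]] by (simp_all add: refines_def)
    show "\<exists>V\<in>\<B>. \<forall>x\<in>V. \<forall>y\<in>V. x \<otimes> y \<in> U" by (rule bexE[OF RU(1)]) (use RB[OF U] in blast)
    show "\<exists>V\<in>\<B>. \<forall>x\<in>V. inv x \<in> U" by (rule bexE[OF RU(2)]) (use RB[OF U] in blast)
    show "\<exists>V\<in>\<B>. \<forall>x\<in>V. inv g \<otimes> x \<otimes> g \<in> U" if "g \<in> carrier G" for g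
      by (rule bexE[OF RU(3)[OF that]]) (use RB[OF U] in blast)
  qed
  ultimately show ?thesis using \<B> by blast
qed

lemma omega_narrow_coarser:
  assumes "omega_narrow G T" "\<And>A. openin S A \<Longrightarrow> openin T A"
  shows "omega_narrow G S"
proof -
  have "unit_neighbourhoods G S \<subseteq> unit_neighbourhoods G T"
    using assms(2) unfolding unit_neighbourhoods_def by blast
  then show ?thesis using assms(1) unfolding omega_narrow_def by blast
qed

lemma omega_narrow_countable_coarser_topology:
  assumes narrow: "omega_narrow G T" and "countable \<B>\<^sub>0" and nbhd: "\<forall>U\<in>\<B>\<^sub>0. unit_nbhd G T U"
    and inter: "\<Inter>\<B>\<^sub>0 = {\<one>}"
  shows "\<exists>S u. topological_group G S \<and> countable_unit_base G S u \<and>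
    (\<forall>A. openin S A \<longrightarrow> openin T A) \<and> (\<forall>U\<in>\<B>\<^sub>0. \<exists>V. unit_nbhd G S V \<and> V \<subseteq> U)"
proof -
  obtain \<B> where \<B>: "\<B>\<^sub>0 \<subseteq> \<B>" "countable \<B>" "\<And>U. U \<in> \<B> \<Longrightarrow> unit_nbhd G T U" "group_base G \<B>"
    using omega_narrow_countable_group_base[OF assms(1-3)] by blast
  interpret B: group_base G \<B> by fact
  have "\<Inter>\<B> = {\<one>}" using inter \<B>(1) B.base_one by blast
  then have S: "topological_group G (group_topology G \<B>)" by (rule B.group_topology_group)
  obtain u where u: "countable_unit_base G (group_topology G \<B>) u"
    using B.countable_unit_base_group_topology[OF \<B>(2)] by blast
  have le: "openin T A" if A: "openin (group_topology G \<B>) A" for A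
  proof (rule group_topology_le[OF _ S A])
    fix V assume "unit_nbhd G (group_topology G \<B>) V"
    then obtain U where "U \<in> \<B>" "U \<subseteq> V" using B.group_topology_base(2) by blast
    then show "\<exists>U. unit_nbhd G T U \<and> U \<subseteq> V" using \<B>(3) by blast
  qed
  have "\<exists>V. unit_nbhd G (group_topology G \<B>) V \<and> V \<subseteq> U" if "U \<in> \<B>\<^sub>0" for U
    using B.group_topology_base(1)[of U] \<B>(1) that by blast
  with S u le show ?thesis by blast
qed

lemma countable_pseudocharacter_unit:
  assumes "countable_pseudocharacter T"
  shows "\<exists>\<B>. countable \<B> \<and> (\<forall>U\<in>\<B>. unit_nbhd G T U) \<and> \<Inter>\<B> = {\<one>}"
proof -
  have "\<exists>\<U>. countable \<U> \<and> (\<forall>U\<in>\<U>. openin T U) \<and> \<Inter>\<U> = {\<one>}"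
    using assms one_closed by (simp add: countable_pseudocharacter_def topspace_eq_carrier)
  then obtain \<U> where \<U>: "countable \<U>" "\<forall>U\<in>\<U>. openin T U" "\<Inter>\<U> = {\<one>}" by (elim exE conjE)
  then have "\<forall>U\<in>\<U>. \<one> \<in> U" by auto
  with \<U> show ?thesis by (intro exI[of _ \<U>]) (simp add: unit_nbhd_def)
qed

lemma Inter_countable_unit_base:
  assumes "countable_unit_base G T u"
  shows "\<Inter>(range u) = {\<one>}"
proof (intro equalityI subsetI)
  fix x assume x: "x \<in> \<Inter>(range u)"
  then have "x \<in> carrier G"
    using assms unit_nbhd_carrier unfolding countable_unit_base_def by blast
  moreover have "x \<in> U" if "unit_nbhd G T U" for U
    using that x assms unfolding countable_unit_base_def by blast
  ultimately show "x \<in> {\<one>}" using unit_nbhd_separates by blast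
qed (use assms in \<open>auto simp: countable_unit_base_def unit_nbhd_def\<close>)

section \<open>Groups all of whose coarser topologies are complete\<close>

context
  assumes narrow: "omega_narrow G T"
    and complete: "\<And>S. topological_group G S \<Longrightarrow> (\<And>A. openin S A \<Longrightarrow> openin T A) \<Longrightarrow> complete_group G S"
begin

text \<open>The base of \<open>S\<close> is also a base of \<open>T\<close>: for a given \<open>U\<close>, adding \<open>U\<close> to the base of \<open>S\<close> gives a
  finer topology \<open>R\<close> of the same kind, and the open mapping theorem makes \<open>R\<close> equal to \<open>S\<close>.\<close>

lemma countable_unit_base_if_coarser_complete:
  assumes "countable_pseudocharacter T"
  shows "\<exists>u. countable_unit_base G T u"
proof -
  obtain \<B> where \<B>: "countable \<B>" "\<forall>U\<in>\<B>. unit_nbhd G T U" "\<Inter>\<B> = {\<one>}"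
    using countable_pseudocharacter_unit[OF assms] by blast
  obtain S u where S: "topological_group G S" "countable_unit_base G S u"
    "\<forall>A. openin S A \<longrightarrow> openin T A"
    using omega_narrow_countable_coarser_topology[OF narrow \<B>] by (elim exE conjE)
  note ST = S(3)[rule_format]
  interpret S: topological_group G S by (rule S(1))
  have u: "unit_nbhd G T (u n)" for n
    using S(2,3) by (auto simp: countable_unit_base_def unit_nbhd_def)
  have "\<exists>V. unit_nbhd G S V \<and> V \<subseteq> U" if U: "unit_nbhd G T U" for U
  proof -
    let ?B = "insert U (range u)"
    have inter: "\<Inter>?B = {\<one>}" using S.Inter_countable_unit_base[OF S(2)] U by (auto simp: unit_nbhd_def)
    have cB: "countable ?B" and nB: "\<forall>V\<in>?B. unit_nbhd G T V" using U u by auto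
    obtain R v where R: "topological_group G R" "countable_unit_base G R v"
      "\<forall>A. openin R A \<longrightarrow> openin T A" "\<forall>V\<in>?B. \<exists>W. unit_nbhd G R W \<and> W \<subseteq> V"
      using omega_narrow_countable_coarser_topology[OF narrow cB nB inter] by (elim exE conjE)
    note RT = R(3)[rule_format]
    interpret R: topological_group G R by (rule R(1))
    have SR: "openin R A" if A: "openin S A" for A
    proof (rule R.group_topology_le[OF _ S(1) A])
      fix V assume "unit_nbhd G S V"
      then obtain n where n: "u n \<subseteq> V" using S(2) by (auto simp: countable_unit_base_def)
      obtain W where "unit_nbhd G R W" "W \<subseteq> u n" using R(4)[rule_format, of "u n"] by blast
      then show "\<exists>W. unit_nbhd G R W \<and> W \<subseteq> V" using n by blast
    qed
    obtain W where W: "unit_nbhd G R W" "W \<subseteq> U" using R(4)[rule_format, of U] by blast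
    have "openin S W"
      by (rule R.open_mapping[OF S(1) omega_narrow_coarser[OF narrow RT] SR
            complete[OF S(1) ST] S(2) complete[OF R(1) RT] R(2)])
        (use W in \<open>auto simp: unit_nbhd_def\<close>)
    then show ?thesis using W by (auto simp: unit_nbhd_def)
  qed
  then have "\<exists>n. u n \<subseteq> U" if "unit_nbhd G T U" for U
    using that S(2) unfolding countable_unit_base_def by (meson order_trans)
  then show ?thesis using u unfolding countable_unit_base_def by blast
qed

text \<open>The sets \<open>c u\<^sub>n\<close>, \<open>c \<in> C n\<close>, form a countable network of \<open>T\<close> and hence of \<open>S\<close>. Whenever such a set is disjoint
  from some \<open>S\<close>-neighbourhood of the unit, one such neighbourhood is chosen; each \<open>x \<noteq> \<one>\<close> lies in a set
  of the network for which this happens.\<close>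

lemma coarser_countable_pseudocharacter:
  assumes u: "countable_unit_base G T u" and S: "topological_group G S"
    and coarser: "\<And>A. openin S A \<Longrightarrow> openin T A"
  shows "\<exists>\<B>. countable \<B> \<and> (\<forall>U\<in>\<B>. unit_nbhd G S U) \<and> \<Inter>\<B> = {\<one>}"
proof -
  interpret S: topological_group G S by fact
  have "\<exists>C. C \<subseteq> carrier G \<and> countable C \<and> carrier G = C <#> u n" for n
    using narrow unit_nbhd_imp_neighbourhood u unfolding omega_narrow_def countable_unit_base_def by blast
  then obtain C where C: "\<And>n. C n \<subseteq> carrier G" "\<And>n. countable (C n)" "\<And>n. carrier G = C n <#> u n"
    by metis
  define I where "I = (SIGMA n:UNIV. C n)"
  define good where "good p W \<longleftrightarrow> unit_nbhd G S W \<and> (\<forall>v\<in>u (fst p). snd p \<otimes> v \<notin> W)" for p W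
  define \<B> where "\<B> = insert (carrier G) ((\<lambda>p. SOME W. good p W) ` {p \<in> I. \<exists>W. good p W})"
  have good: "good p (SOME W. good p W)" if "\<exists>W. good p W" for p
    using that by (rule someI_ex)
  have "countable I" unfolding I_def using C(2) by (intro countable_SIGMA) auto
  then have "countable \<B>" unfolding \<B>_def by (intro countable_insert countable_image) (auto intro: countable_subset)
  moreover have nbhd: "\<forall>U\<in>\<B>. unit_nbhd G S U"
    unfolding \<B>_def using S.unit_nbhd_top good unfolding good_def by blast
  moreover have "\<Inter>\<B> = {\<one>}"
  proof (intro equalityI subsetI)
    show "x \<in> \<Inter>\<B>" if "x \<in> {\<one>}" for x using that nbhd by (auto simp: unit_nbhd_def)
    fix x assume x: "x \<in> \<Inter>\<B>"
    then have xc: "x \<in> carrier G" by (auto simp: \<B>_def)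
    show "x \<in> {\<one>}"
    proof (rule ccontr)
      assume "x \<notin> {\<one>}"
      then obtain P Q where PQ: "openin S P" "openin S Q" "x \<in> P" "\<one> \<in> Q" "disjnt P Q"
        using S.Hausdorff xc unfolding Hausdorff_space_def S.topspace_eq_carrier by blast
      obtain U where U: "unit_nbhd G T U" "\<And>y. y \<in> U \<Longrightarrow> x \<otimes> y \<in> P"
        using open_contains_translate[OF coarser[OF PQ(1)] PQ(3)] by blast
      obtain V where V: "unit_nbhd G T V" "\<And>v. v\<in>V \<Longrightarrow> inv v \<in> V"
        "\<And>v w. v\<in>V \<Longrightarrow> w\<in>V \<Longrightarrow> v \<otimes> w \<in> U"
        using unit_nbhd_symmetric_cube[OF U(1)] by metis
      obtain n where n: "u n \<subseteq> V" using u V(1) by (auto simp: countable_unit_base_def)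
      obtain c v where cv: "c \<in> C n" "v \<in> u n" "x = c \<otimes> v" using xc C(3)[of n] by (auto simp: set_mult_def)
      have c: "c \<in> carrier G" "v \<in> carrier G" using cv C(1) n unit_nbhd_carrier[OF V(1)] by auto
      have "c \<otimes> w \<notin> Q" if w: "w \<in> u n" for w
      proof -
        have "x \<otimes> (inv v \<otimes> w) \<in> P" using U V n cv w by blast
        moreover have "w \<in> carrier G" using w n unit_nbhd_carrier[OF V(1)] by auto
        ultimately have "c \<otimes> w \<in> P" using c cv(3) by (simp add: group_normalize)
        then show ?thesis using PQ(5) by (auto simp: disjnt_def)
      qed
      then have ex: "\<exists>W. good (n, c) W" using PQ by (auto simp: good_def unit_nbhd_def)
      moreover have "(n, c) \<in> I" using cv(1) by (simp add: I_def)
      ultimately have "x \<in> (SOME W. good (n, c) W)" using x by (auto simp: \<B>_def)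
      moreover have "x \<notin> (SOME W. good (n, c) W)" using good[OF ex] cv by (auto simp: good_def)
      ultimately show False by blast
    qed
  qed
  ultimately show ?thesis by blast
qed

text \<open>Below \<open>S\<close> there is a complete topology \<open>R\<close> with a countable base; by the open mapping theorem \<open>R = T\<close>,
  and \<open>S\<close> lies between the two.\<close>

theorem coarser_group_topology_eq:
  assumes "countable_pseudocharacter T" and S: "topological_group G S"
    and coarser: "\<And>A. openin S A \<Longrightarrow> openin T A" and A: "openin T A"
  shows "openin S A"
proof -
  interpret S: topological_group G S by fact
  obtain u where u: "countable_unit_base G T u"
    using countable_unit_base_if_coarser_complete[OF assms(1)] by blast
  obtain \<B> where \<B>: "countable \<B>" "\<forall>U\<in>\<B>. unit_nbhd G S U" "\<Inter>\<B> = {\<one>}"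
    using coarser_countable_pseudocharacter[OF u S coarser] by blast
  have narrow_S: "omega_narrow G S" using narrow coarser by (rule omega_narrow_coarser)
  obtain R v where R: "topological_group G R" "countable_unit_base G R v"
    "\<forall>B. openin R B \<longrightarrow> openin S B"
    using S.omega_narrow_countable_coarser_topology[OF narrow_S \<B>]
    by (elim exE conjE)
  note RS = R(3)[rule_format]
  have RT: "openin T A" if "openin R A" for A using RS[OF that] coarser by blast
  have "complete_group G T" by (rule complete[OF topological_group_axioms])
  from open_mapping[OF R(1) narrow RT complete[OF R(1) RT] R(2) this u A] show ?thesis
    by (rule RS)
qed

end

end

section \<open>Transport of group topologies\<close>

lemma topological_group_pullback:
  assumes "group G" "topological_group H S" "h \<in> hom G H" "inj_on h (carrier G)"
  shows "topological_group G (pullback_topology (carrier G) h S)"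
proof -
  interpret G: group G by fact
  interpret S: topological_group H S by fact
  interpret group_hom G H h
    using assms(3) by (simp add: group_hom_def group_hom_axioms_def assms(1) S.is_group)
  let ?T = "pullback_topology (carrier G) h S"
  have h: "continuous_map ?T S h" by (simp add: continuous_map_pullback[of S S id, simplified])
  have top: "topspace ?T = carrier G"
    by (auto simp: topspace_pullback_topology S.topspace_eq_carrier)
  show ?thesis
  proof
    show "topspace ?T = carrier G" by (rule top)
    have "continuous_map (prod_topology ?T ?T) S (\<lambda>z. h (fst z) \<otimes>\<^bsub>H\<^esub> h (snd z))"
      by (intro S.continuous_mult_pair continuous_map_compose[OF _ h, unfolded o_def]
          continuous_map_fst continuous_map_snd)
    then have "continuous_map (prod_topology ?T ?T) S (h \<circ> (\<lambda>(x, y). x \<otimes>\<^bsub>G\<^esub> y))"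
      by (rule continuous_map_eq) (auto simp: top)
    then show "continuous_map (prod_topology ?T ?T) ?T (\<lambda>(x, y). x \<otimes>\<^bsub>G\<^esub> y)"
      by (rule continuous_map_pullback') (auto simp: top)
    have "continuous_map ?T S (\<lambda>x. inv\<^bsub>H\<^esub> (h x))"
      using continuous_map_compose[OF h S.continuous_inv] by (simp add: o_def)
    then have "continuous_map ?T S (h \<circ> (\<lambda>x. inv\<^bsub>G\<^esub> x))"
      by (rule continuous_map_eq) (auto simp: top)
    then show "continuous_map ?T ?T (\<lambda>x. inv\<^bsub>G\<^esub> x)"
      by (rule continuous_map_pullback') (auto simp: top)
    show "Hausdorff_space ?T"
      by (rule Hausdorff_space_injective_preimage[OF S.Hausdorff h]) (simp add: top assms(4))
  qed
qed

text \<open>Being \<open>i:TG\<close>-closed in groups over a universe implies the same for any smaller universe, because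
  groups over the latter can be copied along the injection. This allows the completion, a group of
  filters, to serve as a target group.\<close>

lemma iTG_closed_inj:
  fixes j :: "'c \<Rightarrow> 'b"
  assumes "inj j" "iTG_closed TYPE('b) G T"
  shows "iTG_closed TYPE('c) G T"
  unfolding iTG_closed_def
proof (intro allI impI, elim conjE)
  fix H :: "'c monoid" and S f
  assume H: "topological_group H S" and f: "f \<in> hom G H" "inj_on f (carrier G)" "continuous_map T S f"
  interpret S: topological_group H S by (rule H)
  define k where "k = inv_into UNIV j"
  have kj [simp]: "k (j x) = x" for x using assms(1) by (simp add: k_def)
  define H' where "H' = \<lparr>carrier = j ` carrier H, mult = \<lambda>x y. j (k x \<otimes>\<^bsub>H\<^esub> k y), one = j \<one>\<^bsub>H\<^esub>\<rparr>"
  define S' where "S' = pullback_topology (carrier H') k S"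
  have "group H'"
  proof (rule groupI)
    fix x assume "x \<in> carrier H'"
    then show "\<exists>y\<in>carrier H'. y \<otimes>\<^bsub>H'\<^esub> x = \<one>\<^bsub>H'\<^esub>"
      by (intro bexI[of _ "j (inv\<^bsub>H\<^esub> (k x))"]) (auto simp: H'_def)
  qed (auto simp: H'_def S.m_assoc)
  moreover have "k \<in> hom H' H" "inj_on k (carrier H')"
    by (auto simp: hom_def H'_def inj_on_def)
  ultimately have S': "topological_group H' S'"
    unfolding S'_def using H by (intro topological_group_pullback)
  have j: "continuous_map S S' j"
    unfolding S'_def
    by (rule continuous_map_pullback') (auto simp: H'_def o_def S.topspace_eq_carrier)
  have "closedin S' ((j \<circ> f) ` carrier G)"
  proof -
    have "j \<circ> f \<in> hom G H'" using f(1) by (auto simp: hom_def H'_def)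
    moreover have "inj_on (j \<circ> f) (carrier G)"
      using f(2) assms(1) by (auto simp: inj_on_def)
    ultimately show ?thesis
      using assms(2) S' continuous_map_compose[OF f(3) j] unfolding iTG_closed_def by blast
  qed
  from closedin_continuous_map_preimage[OF j this]
  have "closedin S {x \<in> topspace S. j x \<in> (j \<circ> f) ` carrier G}" .
  moreover have "{x \<in> topspace S. j x \<in> (j \<circ> f) ` carrier G} = f ` carrier G"
    using f(1) assms(1) by (auto simp: S.topspace_eq_carrier hom_def inj_def)
  ultimately show "closedin S (f ` carrier G)" by simp
qed

section \<open>Closedness implies completeness\<close>

text \<open>A filter is determined by the set of its members.\<close>

lemma inj_filter_members: "inj (\<lambda>F. Inl {A. \<forall>\<^sub>F x in F. x \<in> A} :: 'a set set + 'b)"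
proof (rule injI)
  fix F E :: "'a filter"
  assume "(Inl {A. \<forall>\<^sub>F x in F. x \<in> A} :: 'a set set + 'b) = Inl {A. \<forall>\<^sub>F x in E. x \<in> A}"
  then have "(\<forall>\<^sub>F x in F. x \<in> A) = (\<forall>\<^sub>F x in E. x \<in> A)" for A by auto
  from this[of "Collect P" for P] show "F = E" by (simp add: filter_eq_iff)
qed

text \<open>The identity into the coarser topology, followed by the embedding into its completion, is an
  injective continuous homomorphism, so its image is closed.\<close>

lemma (in topological_group) complete_if_iTG_closed:
  assumes "iTG_closed TYPE('a filter) G T" and S: "topological_group G S"
    and coarser: "\<And>A. openin S A \<Longrightarrow> openin T A"
  shows "complete_group G S"
proof -
  interpret S: topological_group G S by fact
  have "continuous_map T S.completion_topology S.completion_embed"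
  proof (rule continuous_hom_at_unit[OF S.topological_group_completion S.completion_embed_hom])
    fix W assume "unit_nbhd S.completion S.completion_topology W"
    then obtain U where U: "unit_nbhd G S U" "S.completion_nbhd U \<subseteq> W"
      using group_base.group_topology_base(2)[OF S.group_base_completion]
      unfolding S.completion_base_def by blast
    then show "\<exists>V. unit_nbhd G T V \<and> S.completion_embed ` V \<subseteq> W"
      using S.completion_embed_nbhd[OF U(1)] coarser by (intro exI[of _ U]) (auto simp: unit_nbhd_def)
  qed
  then have "closedin S.completion_topology (S.completion_embed ` carrier G)"
    using assms(1) S.topological_group_completion S.completion_embed_hom S.completion_embed_inj
    unfolding iTG_closed_def by blast
  then show ?thesis by (rule S.complete_if_closed_in_completion)
qed

section \<open>Complete minimal groups\<close>

text \<open>If \<open>y\<close> is in the closure of the image, the preimages of the neighbourhoods of \<open>y\<close> generate a Cauchy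
  filter, and \<open>y\<close> is the image of its limit. The hypothesis \<open>embed\<close> says that \<open>f\<close> is open onto its
  image at the unit.\<close>

lemma (in topological_group) closed_if_complete_embedding:
  assumes "complete_group G T" and H: "topological_group H S" and f: "f \<in> hom G H" "continuous_map T S f"
    and embed: "\<And>U. unit_nbhd G T U \<Longrightarrow> \<exists>W. unit_nbhd H S W \<and> (\<forall>x\<in>carrier G. f x \<in> W \<longrightarrow> x \<in> U)"
  shows "closedin S (f ` carrier G)"
proof -
  interpret S: topological_group H S by fact
  interpret group_hom G H f
    using f(1) by (simp add: group_hom_def group_hom_axioms_def is_group S.is_group)
  have "y \<in> f ` carrier G" if y: "y \<in> S closure_of (f ` carrier G)" for y
  proof -
    have yc: "y \<in> carrier H" using y by (simp add: in_closure_of S.topspace_eq_carrier)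
    define F where "F = inf (filtercomap f (nhdsin S y)) (principal (carrier G))"
    have F: "eventually P F \<longleftrightarrow> (\<exists>A. openin S A \<and> y \<in> A \<and> (\<forall>x\<in>carrier G. f x \<in> A \<longrightarrow> P x))" for P
    proof
      assume "eventually P F"
      then obtain Q where Q: "eventually Q (nhdsin S y)" "\<And>x. Q (f x) \<Longrightarrow> x \<in> carrier G \<Longrightarrow> P x"
        unfolding F_def eventually_inf_principal eventually_filtercomap by blast
      from Q(1) yc obtain A where "openin S A" "y \<in> A" "\<forall>z\<in>A. Q z"
        by (auto simp: eventually_nhdsin S.topspace_eq_carrier)
      with Q(2) show "\<exists>A. openin S A \<and> y \<in> A \<and> (\<forall>x\<in>carrier G. f x \<in> A \<longrightarrow> P x)" by blast
    next
      assume "\<exists>A. openin S A \<and> y \<in> A \<and> (\<forall>x\<in>carrier G. f x \<in> A \<longrightarrow> P x)"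
      then obtain A where A: "openin S A" "y \<in> A" "\<forall>x\<in>carrier G. f x \<in> A \<longrightarrow> P x" by blast
      then have "eventually (\<lambda>z. z \<in> A) (nhdsin S y)" by (auto simp: eventually_nhdsin)
      with A(3) show "eventually P F"
        unfolding F_def eventually_inf_principal eventually_filtercomap by blast
    qed
    have "F \<noteq> bot"
      unfolding trivial_limit_def F
    proof
      assume "\<exists>A. openin S A \<and> y \<in> A \<and> (\<forall>x\<in>carrier G. f x \<in> A \<longrightarrow> False)"
      then obtain A where A: "openin S A" "y \<in> A" "\<forall>x\<in>carrier G. f x \<notin> A" by blast
      from closure_of_meets[OF y A(1,2)] A(3) show False by blast
    qed
    moreover have "F \<times>\<^sub>F F \<le> two_sided_uniformity G T"
      unfolding Cauchy_iff_small_sets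
    proof (intro allI impI)
      fix U assume "unit_nbhd G T U"
      then obtain W where W: "unit_nbhd H S W" "\<And>x. x \<in> carrier G \<Longrightarrow> f x \<in> W \<Longrightarrow> x \<in> U"
        using embed by blast
      obtain B where B: "openin S B" "y \<in> B" "small_set H W B"
        using S.open_shrink_small[of "carrier H" y W] W(1) yc S.unit_nbhd_top by (auto simp: unit_nbhd_def)
      have "small_set G U {x \<in> carrier G. f x \<in> B}"
        unfolding small_set_def
      proof (intro conjI ballI)
        fix x z assume xz: "x \<in> {x \<in> carrier G. f x \<in> B}" "z \<in> {x \<in> carrier G. f x \<in> B}"
        have "inv\<^bsub>H\<^esub> f x \<otimes>\<^bsub>H\<^esub> f z \<in> W" "f z \<otimes>\<^bsub>H\<^esub> inv\<^bsub>H\<^esub> f x \<in> W"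
          using B(3) xz by (auto simp: small_set_def)
        then show "inv x \<otimes> z \<in> U" "z \<otimes> inv x \<in> U"
          using W(2)[of "inv x \<otimes> z"] W(2)[of "z \<otimes> inv x"] xz by auto
      qed auto
      moreover have "\<forall>\<^sub>F x in F. x \<in> {x \<in> carrier G. f x \<in> B}"
        unfolding F by (rule exI[of _ B]) (use B in auto)
      ultimately show "\<exists>A. (\<forall>\<^sub>F x in F. x \<in> A) \<and> small_set G U A" by blast
    qed
    ultimately obtain x where x: "x \<in> carrier G" "F \<le> nhdsin T x"
      using assms(1) unfolding complete_group_def by blast
    have "y = f x"
    proof (rule ccontr)
      assume "y \<noteq> f x"
      then obtain P Q where PQ: "openin S P" "openin S Q" "y \<in> P" "f x \<in> Q" "disjnt P Q"
        using S.Hausdorff yc x(1) hom_closed unfolding Hausdorff_space_def S.topspace_eq_carrier by metis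
      have "\<forall>\<^sub>F z in nhdsin T x. f z \<in> Q"
        unfolding eventually_nhdsin
        using openin_continuous_map_preimage[OF f(2) PQ(2)] PQ(4) x(1)
        by (intro disjI2 exI[of _ "{z \<in> topspace T. f z \<in> Q}"]) (auto simp: topspace_eq_carrier)
      with x(2) have "\<forall>\<^sub>F z in F. f z \<in> Q" by (rule filter_leD)
      then obtain A where A: "openin S A" "y \<in> A" "\<forall>z\<in>carrier G. f z \<in> A \<longrightarrow> f z \<in> Q"
        unfolding F by blast
      have "y \<in> A \<inter> P" using A(2) PQ(3) by blast
      from closure_of_meets[OF y openin_Int[OF A(1) PQ(1)] this]
      obtain z where "z \<in> f ` carrier G" "z \<in> A \<inter> P" by blast
      then show False using A(3) PQ(5) by (auto simp: disjnt_def)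
    qed
    then show ?thesis using x(1) by blast
  qed
  then show ?thesis
    by (auto simp: closure_of_subset_eq[symmetric] S.topspace_eq_carrier)
qed

text \<open>Minimality is applied to the image of \<open>f\<close> as a subgroup of \<open>H\<close>, over the same universe as \<open>H\<close>.\<close>

lemma iTG_closed_if_complete_minimal:
  assumes "topological_group G T" "complete_group G T" "minimal_group TYPE('b) G T"
  shows "iTG_closed TYPE('b) G T"
  unfolding iTG_closed_def
proof (intro allI impI, elim conjE)
  interpret T: topological_group G T by fact
  fix H :: "'b monoid" and S f
  assume H: "topological_group H S" and f: "f \<in> hom G H" "inj_on f (carrier G)" "continuous_map T S f"
  interpret S: topological_group H S by (rule H)
  interpret group_hom G H f
    using f(1) by (simp add: group_hom_def group_hom_axioms_def T.is_group S.is_group)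
  define I where "I = H\<lparr>carrier := f ` carrier G\<rparr>"
  have "group I" unfolding I_def by (rule subgroup.subgroup_is_group[OF img_is_subgroup S.is_group])
  moreover have "(\<lambda>x. x) \<in> hom I H" by (auto simp: hom_def I_def)
  ultimately have I: "topological_group I (pullback_topology (carrier I) (\<lambda>x. x) S)" (is "topological_group I ?S")
    using H by (intro topological_group_pullback) auto
  have "f \<in> hom G I" "bij_betw f (carrier G) (carrier I)"
    using f(2) by (auto simp: hom_def I_def bij_betw_def)
  moreover have "continuous_map T ?S f"
    by (rule continuous_map_pullback') (use f(3) in \<open>auto simp: o_def I_def T.topspace_eq_carrier\<close>)
  ultimately have op: "open_map T ?S f"
    using assms(3) I unfolding minimal_group_def by blast
  show "closedin S (f ` carrier G)"
  proof (rule T.closed_if_complete_embedding[OF assms(2) H f(1,3)])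
    fix U assume U: "unit_nbhd G T U"
    then have "openin ?S (f ` U)" using op by (auto simp: open_map_def unit_nbhd_def)
    then obtain W where W: "openin S W" "f ` U = W \<inter> carrier I"
      unfolding openin_pullback_topology by auto
    have "\<one>\<^bsub>H\<^esub> \<in> f ` U" using U by (force simp: unit_nbhd_def)
    then have "unit_nbhd H S W" using W by (auto simp: unit_nbhd_def)
    moreover have "x \<in> U" if x: "x \<in> carrier G" "f x \<in> W" for x
    proof -
      have "f x \<in> f ` U" using W(2) x by (auto simp: I_def)
      then show ?thesis using inj_on_image_mem_iff[OF f(2) x(1)] T.unit_nbhd_carrier[OF U] by blast
    qed
    ultimately show "\<exists>W. unit_nbhd H S W \<and> (\<forall>x\<in>carrier G. f x \<in> W \<longrightarrow> x \<in> U)" by blast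
  qed
qed

section \<open>Closedness, completeness and minimality\<close>

text \<open>A continuous bijective homomorphism out of \<open>X\<close> is treated as a coarser group topology on \<open>X\<close>, its
  pullback topology, to which \<open>coarser_group_topology_eq\<close> applies.\<close>

theorem theorem1p15:
  fixes X :: "('a, 'm) monoid_scheme" and T :: "'a topology"
  assumes "topological_group X T"
    and "omega_narrow X T"
    and "countable_pseudocharacter T"
  shows "iTG_closed TYPE(('a, 'b) universe) X T \<longleftrightarrow>
         complete_group X T \<and> minimal_group TYPE(('a, 'b) universe) X T"
proof (intro iffI conjI; (elim conjE)?)
  interpret topological_group X T by fact
  assume closed: "iTG_closed TYPE(('a, 'b) universe) X T"
  have "iTG_closed TYPE('a filter) X T"
    by (rule iTG_closed_inj[OF inj_filter_members closed])
  note complete = complete_if_iTG_closed[OF this]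
  show "complete_group X T" by (rule complete[OF assms(1)])
  show "minimal_group TYPE(('a, 'b) universe) X T"
    unfolding minimal_group_def open_map_def
  proof (intro allI impI, elim conjE)
    fix H :: "('a, 'b) universe monoid" and S h A
    assume H: "topological_group H S" and h: "h \<in> hom X H" "bij_betw h (carrier X) (carrier H)"
      "continuous_map T S h" and A: "openin T A"
    interpret S: topological_group H S by (rule H)
    let ?S = "pullback_topology (carrier X) h S"
    have "topological_group X ?S"
      using topological_group_pullback[OF is_group H h(1)] h(2) by (simp add: bij_betw_def)
    moreover have "openin T B" if B: "openin ?S B" for B
    proof -
      obtain W where "openin S W" "B = h -` W \<inter> carrier X"
        using B unfolding openin_pullback_topology by blast
      moreover have "h -` W \<inter> carrier X = {x \<in> topspace T. h x \<in> W}"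
        by (auto simp: topspace_eq_carrier)
      ultimately show ?thesis using openin_continuous_map_preimage[OF h(3)] by simp
    qed
    ultimately have "openin ?S A"
      using coarser_group_topology_eq[OF assms(2) complete assms(3)] A by blast
    then obtain W where W: "openin S W" "A = h -` W \<inter> carrier X"
      unfolding openin_pullback_topology by blast
    have "W \<subseteq> h ` carrier X" using W(1) S.open_carrier h(2) by (auto simp: bij_betw_def)
    then have "h ` A = W" using W(2) by auto
    then show "openin S (h ` A)" using W(1) by simp
  qed
qed (rule iTG_closed_if_complete_minimal[OF assms(1)])

end
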